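(* Let $\Omega\subset\mathbb{R}^d$ be compact and convex, $R:=\sup_{x\in\Omega}\|x\|$, let $\mu_1,\dots,\mu_n\in\mathcal{P}(\Omega)$, and let $w_1,\dots,w_n\ge 0$ with $\sum_{i=1}^n w_i=1$. Let $\mathcal{E}(\lambda)=\sum_{i=1}^n \frac{w_i}{2}W_2^2(\mu_i,\lambda)$ for $\lambda\in\mathcal{P}(\Omega)$, and let $\lambda^\star\in\arg\min_{\lambda\in\mathcal{P}(\Omega)}\mathcal{E}(\lambda)$ be a Wasserstein barycenter. Assume that at least one of $\mu_1,\dots,\mu_n$ is absolutely continuous with respect to Lebesgue measure. Let $\lambda^0\in\mathcal{P}_{\mathrm{ac}}(\Omega)$ have density $\rho^0$ with $0<a\le\rho^0(x)\le b<\infty$ for all $x\in\Omega$, let $\{\eta_k\}_{k\ge 0}$ be positive step sizes, and let $\lambda^k$, with density $\rho^k$ on $\Omega$, be the iterates of the mirror descent algorithm $$\rho^{k+1}\propto\rho^k\exp\Big(-\eta_k\sum_{i=1}^n w_i\,\phi_{\rho^k\to\mu_i}\Big),$$ where $\phi_{\rho^k\to\mu_i}$ is a Kantorovich potential from $\lambda^k$ to $\mu_i$ and $\propto$ means normalization to a probability density on $\Omega$. Then, for every number of iterations $T$, $$\min_{0\le k\le T}\bigl(\mathcal{E}(\lambda^k)-\mathcal{E}(\lambda^\star)\bigr)\le\frac{D_{\mathrm{KL}}(\lambda^\star\,\|\,\lambda^0)}{\sum_{k=0}^T\eta_k}+2R^4\,\frac{\sum_{k=0}^T\eta_k^2}{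\sum_{k=0}^T\eta_k}.$$
   Context: $\mathcal{P}(\Omega)$ is the set of Borel probability measures supported on $\Omega$, and $\mathcal{P}_{\mathrm{ac}}(\Omega)$ the subset of those absolutely continuous with respect to Lebesgue measure. $\|\cdot\|$ is the Euclidean norm. The 2-Wasserstein distance is $W_2^2(\mu,\nu)=\inf_{\pi\in\Pi(\mu,\nu)}\int\|x-y\|^2\,d\pi(x,y)$, where $\Pi(\mu,\nu)$ is the set of couplings of $\mu$ and $\nu$. Kantorovich duality reads $\frac12W_2^2(\mu,\nu)=\sup_\phi\{\int_\Omega\phi\,d\mu+\int_\Omega\phi^c\,d\nu\}$, with $\phi^c(y)=\inf_{x\in\Omega}\{\|x-y\|^2/2-\phi(x)\}$. A Kantorovich potential $\phi_{\mu\to\nu}$ from $\mu$ to $\nu$ is a maximizer of this dual problem; it is taken to be $c$-concave (i.e. of the form $\phi(x)=\inf_{y\in\Omega}\{\|x-y\|^2/2-\psi(y)\}$ for some extended-real function $\psi$) and finite on $\Omega$, and normalized so that $\inf_{x\in\Omega}\phi_{\mu\to\nu}(x)=0$ (the density update is invariant under adding constants to the potentials). $\phi_{\rho\to\mu}$ denotes the potential from the measure with density $\rho$ to $\mu$. When the target measure $\mu=\sum_j u_j\delta_{x_j}$ is discrete, the potential $\phi_{\rho\to\mu}$ is the $c$-transform $y\mapsto\min_j\{\|y-x_j\|^2/2-\phi_j\}$ of a vector $(\phi_j)$ maximizing the semi-discrete dual $\sum_j u_j\phi_j+\int_\Omega\min_j\{\|y-x_j\|^2/2-\phi_j\}\rho(y)\,dy$.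 $D_{\mathrm{KL}}(\mu\|\nu)=\int\log\frac{d\mu}{d\nu}\,d\mu$ is the Kullback–Leibler divergence, equal to $+\infty$ if $\mu$ is not absolutely continuous with respect to $\nu$. *)

theory Defs
  imports "HOL-Probability.Probability"
begin

definition prob_measures_on :: "'a::euclidean_space set \<Rightarrow> 'a measure set" where
  "prob_measures_on \<Omega> = {M. prob_space M \<and> sets M = sets borel \<and> emeasure M \<Omega> = 1}"

definition ac_prob_measures_on :: "'a::euclidean_space set \<Rightarrow> 'a measure set" where
  "ac_prob_measures_on \<Omega> = {M \<in> prob_measures_on \<Omega>. absolutely_continuous lborel M}"

(* Values of rho outside Omega are irrelevant. *)
definition has_density_on ::
    "'a::euclidean_space measure \<Rightarrow> ('a \<Rightarrow> real) \<Rightarrow> 'a set \<Rightarrow> bool" where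
  "has_density_on M \<rho> \<Omega> \<longleftrightarrow>
     set_borel_measurable lborel \<Omega> \<rho> \<and> (\<forall>x\<in>\<Omega>. 0 \<le> \<rho> x) \<and>
     M = density lborel (\<lambda>x. ennreal (indicator \<Omega> x * \<rho> x))"

definition normalize_on :: "'a::euclidean_space set \<Rightarrow> ('a \<Rightarrow> real) \<Rightarrow> 'a \<Rightarrow> real" where
  "normalize_on \<Omega> f x = f x / (LINT y:\<Omega>|lborel. f y)"

definition couplings ::
    "'a::euclidean_space measure \<Rightarrow> 'a measure \<Rightarrow> ('a \<times> 'a) measure set" where
  "couplings \<mu> \<nu> =
     {\<pi>. prob_space \<pi> \<and> sets \<pi> = sets borel \<and> distr \<pi> borel fst = \<mu> \<and> distr \<pi> borel snd = \<nu>}"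

(* The infimum is taken in [0, \<infinity>]; it is finite for measures supported on a bounded set,
   the only case in which W2 is used, so that enn2real loses nothing. *)
definition W2 :: "'a::euclidean_space measure \<Rightarrow> 'a measure \<Rightarrow> real" where
  "W2 \<mu> \<nu> = sqrt (enn2real
     (INF \<pi>\<in>couplings \<mu> \<nu>. \<integral>\<^sup>+ (x, y). ennreal ((norm (x - y))\<^sup>2) \<partial>\<pi>))"

definition barycenter_energy ::
    "nat \<Rightarrow> (nat \<Rightarrow> real) \<Rightarrow> (nat \<Rightarrow> 'a::euclidean_space measure) \<Rightarrow> 'a measure \<Rightarrow> real" where
  "barycenter_energy n w \<mu> M = (\<Sum>i=1..n. w i / 2 * (W2 (\<mu> i) M)\<^sup>2)"

definition c_transform :: "'a::euclidean_space set \<Rightarrow> ('a \<Rightarrow> real) \<Rightarrow> 'a \<Rightarrow> real" where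
  "c_transform \<Omega> \<phi> y = (INF x\<in>\<Omega>. (norm (x - y))\<^sup>2 / 2 - \<phi> x)"

(* The dual problem ranges over all real-valued phi for which the objective is a real number.
   For bounded Omega, the c-transform of phi is identically -\<infinity> if phi is not bounded above
   on Omega, and is finite and Lipschitz on Omega otherwise. *)
definition dual_admissible ::
    "'a::euclidean_space set \<Rightarrow> 'a measure \<Rightarrow> ('a \<Rightarrow> real) \<Rightarrow> bool" where
  "dual_admissible \<Omega> \<mu> \<phi> \<longleftrightarrow> set_integrable \<mu> \<Omega> \<phi> \<and> bdd_above (\<phi> ` \<Omega>)"

definition dual_objective ::
    "'a::euclidean_space set \<Rightarrow> 'a measure \<Rightarrow> 'a measure \<Rightarrow> ('a \<Rightarrow> real) \<Rightarrow> real" where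
  "dual_objective \<Omega> \<mu> \<nu> \<phi> =
     (LINT x:\<Omega>|\<mu>. \<phi> x) + (LINT y:\<Omega>|\<nu>. c_transform \<Omega> \<phi> y)"

definition c_concave_on :: "'a::euclidean_space set \<Rightarrow> ('a \<Rightarrow> real) \<Rightarrow> bool" where
  "c_concave_on \<Omega> \<phi> \<longleftrightarrow>
     (\<exists>\<psi> :: 'a \<Rightarrow> ereal. \<forall>x\<in>\<Omega>. ereal (\<phi> x) = (INF y\<in>\<Omega>. ereal ((norm (x - y))\<^sup>2 / 2) - \<psi> y))"

(* The infimum in the normalization is that of a bounded set: a finite c-concave function
   oscillates by at most half the squared diameter of Omega. *)
definition kantorovich_potential ::
    "'a::euclidean_space set \<Rightarrow> 'a measure \<Rightarrow> 'a measure \<Rightarrow> ('a \<Rightarrow> real) \<Rightarrow> bool" where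
  "kantorovich_potential \<Omega> \<mu> \<nu> \<phi> \<longleftrightarrow>
     is_arg_max (dual_objective \<Omega> \<mu> \<nu>) (dual_admissible \<Omega> \<mu>) \<phi> \<and>
     c_concave_on \<Omega> \<phi> \<and> (INF x\<in>\<Omega>. \<phi> x) = 0"

(* KL_divergence b N M is D(M || N) with logarithm to base b, but as a Bochner integral it is 0
   when the integral diverges. The negative part of the integrand is always integrable for
   probability measures M << N, so divergence can only be to +\<infinity>. *)
definition D_KL :: "'a measure \<Rightarrow> 'a measure \<Rightarrow> ereal" where
  "D_KL M N =
     (if absolutely_continuous N M \<and> integrable M (entropy_density (exp 1) N M)
      then ereal (KL_divergence (exp 1) N M) else \<infinity>)"

end

theory Submission
  imports Defs
begin

text \<open>
  Let \<open>f\<^sub>k = (\<Sum>i. w i * \<phi> k i)\<close> and let \<open>Z\<^sub>k\<close> be the normalisation constant of the update. The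
  potentials are subgradients of the energy: weak duality for \<open>\<lambda>\<^sup>\<star>\<close> and strong duality for \<open>\<lambda>\<^sup>k\<close>
  give \<open>\<E>(\<lambda>\<^sup>k) - \<E>(\<lambda>\<^sup>\<star>) \<le> \<integral>f\<^sub>k d\<lambda>\<^sup>k - \<integral>f\<^sub>k d\<lambda>\<^sup>\<star>\<close>. A normalised \<open>c\<close>-concave potential takes
  values in \<open>[0, 2R\<^sup>2]\<close>, so \<open>ln Z\<^sub>k \<le> - \<eta>\<^sub>k \<integral>f\<^sub>k d\<lambda>\<^sup>k + 2 R\<^sup>4 \<eta>\<^sub>k\<^sup>2\<close> by
  \<open>exp (- x) \<le> 1 - x + x\<^sup>2/2\<close>. Hence \<open>\<eta>\<^sub>k (\<E>(\<lambda>\<^sup>k) - \<E>(\<lambda>\<^sup>\<star>))\<close> is at most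
  \<open>\<integral>ln (\<rho>\<^sup>k\<^sup>+\<^sup>1/\<rho>\<^sup>k) d\<lambda>\<^sup>\<star> + 2 R\<^sup>4 \<eta>\<^sub>k\<^sup>2\<close>; the first term telescopes, and the
  Donsker--Varadhan inequality bounds its sum by the divergence of \<open>\<lambda>\<^sup>\<star>\<close> from \<open>\<lambda>\<^sup>0\<close>.

  Strong duality is obtained up to an arbitrary error from entropic regularisation: after one
  marginal is moved to finitely many points, the maximiser of the regularised semi-discrete dual
  yields a dual feasible pair together with a coupling of almost the same cost.
\<close>

section \<open>The Donsker--Varadhan inequality\<close>

text \<open>Apply \<open>ln t \<le> t - 1\<close> pointwise to \<open>t = exp (g x) / f x\<close>,
  where \<open>f\<close> is the density of \<open>M\<close> with respect to \<open>N\<close>, and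
  integrate over \<open>M\<close>. The \<open>M\<close>-mean of \<open>t\<close> is the
  \<open>N\<close>-integral of \<open>exp g\<close> over the set \<open>f > 0\<close>, hence at most
  1.\<close>

lemma donsker_varadhan:
  assumes "prob_space N" "prob_space M" and S: "sets M = sets N"
    and ac: "absolutely_continuous N M"
    and ent: "integrable M (entropy_density (exp 1) N M)"
    and g: "integrable M g" and eg: "integrable N (\<lambda>x. exp (g x))"
    and one: "(\<integral>x. exp (g x) \<partial>N) = 1"
  shows "(\<integral>x. g x \<partial>M) \<le> KL_divergence (exp 1) N M"
proof -
  interpret N: prob_space N by fact
  interpret M: prob_space M by fact
  define f where "f = (\<lambda>x. enn2real (RN_deriv N M x))"
  have f_meas[measurable]: "f \<in> borel_measurable N" by (simp add: f_def)
  have f0: "f x \<ge> 0" for x by (simp add: f_def)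
  have gm [measurable]: "g \<in> borel_measurable N"
    using borel_measurable_integrable[OF g] S by (simp cong: measurable_cong_sets)
  have Md: "M = density N (\<lambda>x. ennreal (f x))"
  proof -
    have "density N (RN_deriv N M) = M" by (rule N.density_RN_deriv[OF ac S])
    moreover have "AE x in N. RN_deriv N M x \<noteq> \<infinity>"
      using N.RN_deriv_finite[OF _ ac S] M.sigma_finite_measure_axioms by blast
    hence "AE x in N. RN_deriv N M x = ennreal (f x)"
      by eventually_elim (simp add: f_def less_top)
    hence "density N (RN_deriv N M) = density N (\<lambda>x. ennreal (f x))"
      by (intro density_cong) auto
    ultimately show ?thesis by simp
  qed
  have ed: "entropy_density (exp 1) N M = (\<lambda>x. ln (f x))"
    by (auto simp: entropy_density_def f_def log_def)
  have pos: "AE x in M. f x > 0"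
    by (subst Md, subst AE_density) (auto simp: )
  \<comment> \<open>Division by zero gives 0, so the left side is 0 where \<open>f x = 0\<close> and
    \<open>exp (g x)\<close> elsewhere.\<close>
  have 1: "f x * (exp (g x) / f x) \<le> exp (g x)" for x by simp
  have int1: "integrable N (\<lambda>x. f x * (exp (g x) / f x))"
    by (rule Bochner_Integration.integrable_bound[OF eg]) (auto simp: f0)
  hence intM: "integrable M (\<lambda>x. exp (g x) / f x)"
    by (subst Md, subst integrable_density) (auto simp: f0)
  have "(\<integral>x. exp (g x) / f x \<partial>M) = (\<integral>x. f x * (exp (g x) / f x) \<partial>N)"
    by (subst Md, subst integral_density) (auto simp: f0)
  also have "\<dots> \<le> (\<integral>x. exp (g x) \<partial>N)"
    by (rule integral_mono[OF int1 eg 1])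
  finally have le1: "(\<integral>x. exp (g x) / f x \<partial>M) \<le> 1" using one by simp
  have lnf: "integrable M (\<lambda>x. ln (f x))" using ent ed by simp
  have "(\<integral>x. g x - ln (f x) \<partial>M) \<le> (\<integral>x. exp (g x) / f x - 1 \<partial>M)"
  proof (rule integral_mono_AE)
    show "AE x in M. g x - ln (f x) \<le> exp (g x) / f x - 1"
      using pos
    proof eventually_elim
      case (elim x)
      have "exp (g x - ln (f x)) = exp (g x) / f x" using elim by (simp add: exp_diff)
      thus ?case using exp_ge_add_one_self[of "g x - ln (f x)"] by linarith
    qed
  qed (use g lnf intM in auto)
  also have "\<dots> \<le> 0" using le1 intM by (simp add: M.prob_space)
  finally show ?thesis using g lnf by (simp add: KL_divergence_def ed)
qed

section \<open>Soft assignment to finitely many points\<close>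

text \<open>Tychonoff's theorem: the index type may be infinite, so the box is treated as a product
  of compact intervals in the product topology on functions.\<close>

lemma compact_box:
  fixes l u :: "'i \<Rightarrow> real"
  shows "compact {v. \<forall>i. l i \<le> v i \<and> v i \<le> u i}"
proof -
  have "{v. \<forall>i. l i \<le> v i \<and> v i \<le> u i} = (\<Pi>\<^sub>E i\<in>UNIV. {l i..u i})" by auto
  moreover have "compactin (product_topology (\<lambda>i. euclidean) UNIV) (\<Pi>\<^sub>E i\<in>UNIV. {l i..u i})"
    by (subst compactin_PiE) auto
  ultimately show ?thesis by (simp add: euclidean_product_topology)
qed

definition softmax :: "'i set \<Rightarrow> ('i \<Rightarrow> real) \<Rightarrow> 'i \<Rightarrow> real" where
  "softmax J v j = exp (v j) / (\<Sum>l\<in>J. exp (v l))"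

definition log_sum_exp :: "'i set \<Rightarrow> ('i \<Rightarrow> real) \<Rightarrow> real" where
  "log_sum_exp J v = ln (\<Sum>l\<in>J. exp (v l))"

lemma sum_exp_pos: "finite J \<Longrightarrow> J \<noteq> {} \<Longrightarrow> 0 < (\<Sum>l\<in>J. exp (v l :: real))"
  by (intro sum_pos) auto

lemma exp_log_sum_exp: "finite J \<Longrightarrow> J \<noteq> {} \<Longrightarrow> exp (log_sum_exp J v) = (\<Sum>l\<in>J. exp (v l))"
  by (simp add: log_sum_exp_def sum_exp_pos)

lemma softmax_eq: "finite J \<Longrightarrow> J \<noteq> {} \<Longrightarrow> softmax J v j = exp (v j - log_sum_exp J v)"
  by (simp add: softmax_def exp_diff exp_log_sum_exp)

lemma sum_softmax: "finite J \<Longrightarrow> J \<noteq> {} \<Longrightarrow> (\<Sum>j\<in>J. softmax J v j) = 1"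
  using sum_exp_pos[of J v] by (simp add: softmax_def flip: sum_divide_distrib)

lemma log_sum_exp_mono:
  assumes "finite J" "J \<noteq> {}" "\<And>j. j \<in> J \<Longrightarrow> v j \<le> w j"
  shows "log_sum_exp J v \<le> log_sum_exp J w"
  unfolding log_sum_exp_def using assms sum_exp_pos[of J]
  by (subst ln_le_cancel_iff) (auto intro!: sum_mono)

lemma log_sum_exp_add:
  assumes "finite J" "J \<noteq> {}"
  shows "log_sum_exp J (\<lambda>j. v j + t) = log_sum_exp J v + t"
proof -
  have "(\<Sum>l\<in>J. exp (v l + t)) = (\<Sum>l\<in>J. exp (v l)) * exp t"
    by (simp add: exp_add sum_distrib_right)
  thus ?thesis using sum_exp_pos[OF assms, of v] by (simp add: log_sum_exp_def ln_mult)
qed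

lemma le_log_sum_exp:
  assumes "finite J" "j \<in> J"
  shows "v j \<le> log_sum_exp J v"
proof -
  have "exp (v j) \<le> exp (log_sum_exp J v)"
    using assms by (subst exp_log_sum_exp) (auto intro!: member_le_sum)
  thus ?thesis by simp
qed

text \<open>Raising every coordinate of one vector by the l1 distance makes it dominate the other on
  \<open>J\<close>; monotonicity and equivariance under shifts then give both directions.\<close>

lemma log_sum_exp_lipschitz:
  assumes "finite J" "J \<noteq> {}"
  shows "\<bar>log_sum_exp J v - log_sum_exp J w\<bar> \<le> (\<Sum>j\<in>J. \<bar>v j - w j\<bar>)"
proof -
  let ?d = "\<Sum>j\<in>J. \<bar>v j - w j\<bar>"
  have 1: "\<bar>v j - w j\<bar> \<le> ?d" if "j \<in> J" for j using that assms by (intro member_le_sum) auto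
  have "log_sum_exp J v \<le> log_sum_exp J (\<lambda>j. w j + ?d)"
    using assms 1 by (intro log_sum_exp_mono) (auto simp: abs_le_iff algebra_simps)
  moreover have "log_sum_exp J w \<le> log_sum_exp J (\<lambda>j. v j + ?d)"
    using assms 1 by (intro log_sum_exp_mono) (auto simp: abs_le_iff algebra_simps)
  ultimately show ?thesis using assms by (simp add: log_sum_exp_add)
qed

text \<open>The perturbation multiplies the sum of exponentials by exactly
  \<open>1 + softmax J v j * (exp t - 1)\<close>, and \<open>ln (1 + y) \<le> y\<close>. Since
  \<open>softmax\<close> is the gradient of \<open>log_sum_exp\<close>, this is a one-sided form of
  differentiability that can be integrated directly.\<close>

lemma log_sum_exp_perturb:
  assumes "finite J" "j \<in> J"
  shows "log_sum_exp J (\<lambda>l. v l + (if l = j then t else 0))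
         \<le> log_sum_exp J v + softmax J v j * (exp t - 1)"
proof -
  have J: "J \<noteq> {}" using assms by auto
  let ?S = "\<Sum>l\<in>J. exp (v l)"
  have S: "?S > 0" by (rule sum_exp_pos[OF assms(1) J])
  have "(\<Sum>l\<in>J. exp (v l + (if l = j then t else 0)))
        = (\<Sum>l\<in>J. exp (v l) + (if l = j then exp (v l) * (exp t - 1) else 0))"
    by (intro sum.cong) (auto simp: exp_add algebra_simps)
  also have "\<dots> = ?S + exp (v j) * (exp t - 1)"
    using assms by (simp add: sum.distrib)
  also have "\<dots> = ?S * (1 + softmax J v j * (exp t - 1))"
    using S by (simp add: softmax_def field_simps)
  finally have eq: "(\<Sum>l\<in>J. exp (v l + (if l = j then t else 0)))
      = ?S * (1 + softmax J v j * (exp t - 1))" .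
  have "0 < (\<Sum>l\<in>J. exp (v l + (if l = j then t else 0)))" by (rule sum_exp_pos[OF assms(1) J])
  hence p: "0 < 1 + softmax J v j * (exp t - 1)" using S eq by (simp add: zero_less_mult_iff)
  have "log_sum_exp J (\<lambda>l. v l + (if l = j then t else 0)) = ln ?S + ln (1 + softmax J v j * (exp t - 1))"
    unfolding log_sum_exp_def eq using S p by (simp add: ln_mult)
  also have "\<dots> \<le> ln ?S + softmax J v j * (exp t - 1)"
    using ln_le_minus_one[OF p] by simp
  finally show ?thesis by (simp add: log_sum_exp_def)
qed

lemma softmax_nonneg: "0 \<le> softmax J v j"
  by (simp add: softmax_def sum_nonneg)

lemma softmax_le_1: "finite J \<Longrightarrow> j \<in> J \<Longrightarrow> softmax J v j \<le> 1"
  using le_log_sum_exp[of J j v] by (subst softmax_eq) auto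

text \<open>Divide by \<open>t\<close> and let \<open>t\<close> decrease to 0, where
  \<open>(exp t - 1) / t\<close> tends to 1.\<close>

lemma exp_slope_bound_imp_le:
  assumes "\<And>t. t > 0 \<Longrightarrow> t * q \<le> p * (exp t - 1)"
  shows "q \<le> (p::real)"
proof -
  have "((\<lambda>t. p * ((exp t - 1) / t)) \<longlongrightarrow> p * 1) (at_right (0::real))"
    by (intro tendsto_mult tendsto_const filterlim_mono[OF lim_exp_minus_1 order_refl]) (simp add: at_le)
  moreover have "\<forall>\<^sub>F t in at_right (0::real). q \<le> p * ((exp t - 1) / t)"
    using eventually_at_right_less[of 0]
  proof eventually_elim
    case (elim t)
    thus ?case using assms[of t] by (simp add: field_simps)
  qed
  ultimately show ?thesis by (intro tendsto_lowerbound[of _ p]) auto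
qed

text \<open>The weights maximise the concave semi-discrete dual
  \<open>\<Phi> v = (\<Sum>j\<in>J. q j * v j) - \<integral> log_sum_exp J (\<lambda>l. v l - c l x)\<close>, which is invariant under adding
  constants and coercive modulo constants; perturbing one coordinate of a maximiser gives
  \<open>q j \<le> \<integral> softmax\<close>, and both sides sum to \<open>1\<close>.\<close>
lemma soft_assignment:
  fixes c :: "'i \<Rightarrow> 'b \<Rightarrow> real"
  assumes "prob_space M" and J: "finite J" "J \<noteq> {}"
    and c [measurable]: "\<And>j. c j \<in> borel_measurable M"
    and bnd: "\<And>j. j \<in> J \<Longrightarrow> AE x in M. 0 \<le> c j x \<and> c j x \<le> B"
    and q: "\<And>j. j \<in> J \<Longrightarrow> q j > 0" and q1: "(\<Sum>j\<in>J. q j) = 1"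
  shows "\<exists>v. \<forall>j\<in>J. (\<integral>x. softmax J (\<lambda>l. v l - c l x) j \<partial>M) = q j"
proof -
  interpret prob_space M by fact
  define L where "L = (\<lambda>v x. log_sum_exp J (\<lambda>l. v l - c l x))"
  define \<Phi> where "\<Phi> = (\<lambda>v. (\<Sum>j\<in>J. q j * v j) - (\<integral>x. L v x \<partial>M))"
  have Lm [measurable]: "L v \<in> borel_measurable M" for v
    unfolding L_def log_sum_exp_def by measurable
  have "AE x in M. \<forall>j\<in>J. 0 \<le> c j x \<and> c j x \<le> B"
    using J bnd by (simp add: AE_finite_all)
  hence Lb: "AE x in M. log_sum_exp J v - B \<le> L v x \<and> L v x \<le> log_sum_exp J v" for v
  proof eventually_elim
    case (elim x)
    have "log_sum_exp J (\<lambda>l. v l + (- B)) \<le> L v x"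
      unfolding L_def using elim J by (intro log_sum_exp_mono) auto
    moreover have "L v x \<le> log_sum_exp J v"
      unfolding L_def using elim J by (intro log_sum_exp_mono) auto
    ultimately show ?case using log_sum_exp_add[OF J, of v "- B"] by simp
  qed
  have "AE x in M. norm (L v x) \<le> \<bar>log_sum_exp J v\<bar> + \<bar>log_sum_exp J v - B\<bar>" for v
    using Lb[of v] by (rule eventually_mono) auto
  hence Li [simp]: "integrable M (L v)" for v
    by (intro integrable_const_bound) auto
  have "AE x in M. log_sum_exp J v - B \<le> L v x" for v
    using Lb[of v] by (rule eventually_mono) auto
  hence Lge: "log_sum_exp J v - B \<le> (\<integral>x. L v x \<partial>M)" for v
    by (intro integral_ge_const) auto
  have "AE x in M. L v x \<le> log_sum_exp J v" for v
    using Lb[of v] by (rule eventually_mono) auto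
  hence Lle: "(\<integral>x. L v x \<partial>M) \<le> log_sum_exp J v" for v
    by (intro integral_le_const) auto
  \<comment> \<open>Any vector serves here: the lower and upper bounds of one integral differ by
    \<open>B\<close>.\<close>
  have B0: "B \<ge> 0" using Lge[of undefined] Lle[of undefined] by linarith
  have shift: "\<Phi> (\<lambda>j. v j + t) = \<Phi> v" for v t
  proof -
    have "L (\<lambda>j. v j + t) = (\<lambda>x. L v x + t)"
    proof
      fix x
      show "L (\<lambda>j. v j + t) x = L v x + t"
        unfolding L_def using log_sum_exp_add[OF J, of "\<lambda>l. v l - c l x" t] by (simp add: algebra_simps)
    qed
    moreover have "(\<Sum>j\<in>J. q j * (v j + t)) = (\<Sum>j\<in>J. q j * v j) + t"
      by (simp add: distrib_left sum.distrib q1 flip: sum_distrib_right)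
    ultimately show ?thesis by (simp add: \<Phi>_def prob_space)
  qed
  have cong: "\<Phi> v = \<Phi> w" if "\<And>j. j \<in> J \<Longrightarrow> v j = w j" for v w
    using that by (simp add: \<Phi>_def L_def log_sum_exp_def cong: sum.cong)
  define qm where "qm = Min (q ` J)"
  have qm: "qm > 0" "\<And>j. j \<in> J \<Longrightarrow> qm \<le> q j" using J q by (auto simp: qm_def)
  have card: "ln (real (card J)) \<ge> 0" using J by (simp add: Suc_leI card_gt_0_iff)
  \<comment> \<open>If the largest coordinate is 0 and another one is below \<open>- m\<close>, the
    linear term of \<Phi> is at most \<open>- (B + ln (card J))\<close> while the integral is at
    least \<open>- B\<close>. So \<Phi> does not exceed \<open>- ln (card J)\<close>, a lower bound
    for its value at 0.\<close>
  define m where "m = (B + ln (card J)) / qm"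
  have m0: "m \<ge> 0" using B0 qm card by (simp add: m_def)
  \<comment> \<open>Coordinates outside \<open>J\<close> do not affect \<Phi>; pinning them to 0
    makes the box compact and leaves 0 inside it.\<close>
  define X where "X = {v::'i \<Rightarrow> real. \<forall>i. (if i \<in> J then - m else 0) \<le> v i \<and> v i \<le> 0}"
  have "compact X" unfolding X_def by (rule compact_box[of _ "\<lambda>_. 0", simplified])
  have zero: "(\<lambda>_. 0) \<in> X" using m0 by (auto simp: X_def)
  have \<Phi>0: "- ln (card J) \<le> \<Phi> (\<lambda>_. 0)"
    using Lle[of "\<lambda>_. 0"] by (simp add: \<Phi>_def log_sum_exp_def)
  \<comment> \<open>The bound involves only the finitely many coordinates in \<open>J\<close>, so it
    yields continuity in the product topology.\<close>
  have diff: "\<bar>(\<integral>x. L v x \<partial>M) - (\<integral>x. L w x \<partial>M)\<bar> \<le> (\<Sum>j\<in>J. \<bar>v j - w j\<bar>)" for v w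
  proof -
    have 1: "\<bar>L v x - L w x\<bar> \<le> (\<Sum>j\<in>J. \<bar>v j - w j\<bar>)" for x
      using log_sum_exp_lipschitz[OF J, of "\<lambda>l. v l - c l x" "\<lambda>l. w l - c l x"] by (simp add: L_def)
    have "\<bar>\<integral>x. L v x - L w x \<partial>M\<bar> \<le> (\<integral>x. \<bar>L v x - L w x\<bar> \<partial>M)"
      by (rule integral_abs_bound)
    also have "\<dots> \<le> (\<Sum>j\<in>J. \<bar>v j - w j\<bar>)"
      using 1 by (intro integral_le_const) auto
    finally show ?thesis by simp
  qed
  have coord: "((\<lambda>v. v j) \<longlongrightarrow> w j) (at w within X)" for j w and X :: "('i \<Rightarrow> real) set"
  proof -
    have "continuous_on UNIV (\<lambda>v :: 'i \<Rightarrow> real. v j)"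
      by (rule continuous_on_product_coordinates)
    thus ?thesis by (meson UNIV_I continuous_on_def tendsto_within_subset top_greatest)
  qed
  have cont: "continuous_on X \<Phi>"
    unfolding continuous_on_def
  proof
    fix w
    have "((\<lambda>v. (\<Sum>j\<in>J. \<bar>v j - w j\<bar>)) \<longlongrightarrow> (\<Sum>j\<in>J. \<bar>w j - w j\<bar>)) (at w within X)"
      by (intro tendsto_intros coord)
    hence "((\<lambda>v. (\<Sum>j\<in>J. \<bar>v j - w j\<bar>)) \<longlongrightarrow> 0) (at w within X)" by simp
    moreover have "\<forall>\<^sub>F v in at w within X.
        norm ((\<integral>x. L v x \<partial>M) - (\<integral>x. L w x \<partial>M)) \<le> (\<Sum>j\<in>J. \<bar>v j - w j\<bar>)"
      unfolding real_norm_def by (intro always_eventually allI diff)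
    ultimately have "((\<lambda>v. (\<integral>x. L v x \<partial>M) - (\<integral>x. L w x \<partial>M)) \<longlongrightarrow> 0) (at w within X)"
      by (rule Lim_null_comparison[rotated])
    hence "((\<lambda>v. (\<integral>x. L v x \<partial>M)) \<longlongrightarrow> (\<integral>x. L w x \<partial>M)) (at w within X)"
      by (rule LIM_zero_cancel)
    thus "(\<Phi> \<longlongrightarrow> \<Phi> w) (at w within X)"
      unfolding \<Phi>_def by (intro tendsto_diff tendsto_sum tendsto_mult tendsto_const coord)
  qed
  obtain v where v: "v \<in> X" "\<And>w. w \<in> X \<Longrightarrow> \<Phi> w \<le> \<Phi> v"
    using continuous_attains_sup[OF \<open>compact X\<close> _ cont] zero by blast
  have glob: "\<Phi> w \<le> \<Phi> v" for w
  proof -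
    define t where "t = Max (w ` J)"
    \<comment> \<open>Shift invariance of \<Phi> allows the maximum over \<open>J\<close> to be
      normalised to 0.\<close>
    define w' where "w' = (\<lambda>i. if i \<in> J then w i + (- t) else 0)"
    have eq: "\<Phi> w' = \<Phi> w" using cong[of w' "\<lambda>i. w i + (- t)"] shift[of w "- t"] by (simp add: w'_def)
    have t: "w i \<le> t" if "i \<in> J" for i using J that unfolding t_def by (intro Max_ge) auto
    have le: "w' i \<le> 0" for i using t by (auto simp: w'_def)
    show ?thesis
    proof (cases "w' \<in> X")
      case True
      thus ?thesis using v(2) eq by metis
    next
      case False
      then obtain i where i: "i \<in> J" "w' i < - m" using le by (auto simp: X_def w'_def split: if_splits)
      obtain j where j: "j \<in> J" "w' j = 0"
      proof -
        have "t \<in> w ` J" using J unfolding t_def by (intro Max_in) auto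
        thus ?thesis using that by (auto simp: w'_def)
      qed
      have "(\<Sum>l\<in>J. q l * w' l) = q i * w' i + (\<Sum>l\<in>J - {i}. q l * w' l)"
        using J i by (simp add: sum.remove)
      moreover have "(\<Sum>l\<in>J - {i}. q l * w' l) \<le> 0"
        using le q by (intro sum_nonpos) (auto simp: mult_le_0_iff less_imp_le)
      moreover have "q i * w' i \<le> - (q i * m)"
        using i q[of i] mult_left_mono[of "w' i" "- m" "q i"] by simp
      moreover have "qm * m \<le> q i * m" using qm i m0 by (intro mult_right_mono) auto
      moreover have "qm * m = B + ln (card J)" using qm by (simp add: m_def)
      ultimately have "(\<Sum>l\<in>J. q l * w' l) \<le> - (B + ln (card J))" by linarith
      moreover have "(\<integral>x. L w' x \<partial>M) \<ge> - B"
        using Lge[of w'] le_log_sum_exp[OF J(1) j(1), of w'] j by simp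
      ultimately have "\<Phi> w' \<le> - ln (card J)" unfolding \<Phi>_def by linarith
      thus ?thesis using eq \<Phi>0 v(2)[OF zero] by linarith
    qed
  qed
  let ?P = "\<lambda>j. \<integral>x. softmax J (\<lambda>l. v l - c l x) j \<partial>M"
  have Sm [measurable]: "(\<lambda>x. softmax J (\<lambda>l. v l - c l x) j) \<in> borel_measurable M" for j
    unfolding softmax_def by measurable
  have Si: "integrable M (\<lambda>x. softmax J (\<lambda>l. v l - c l x) j)" if "j \<in> J" for j
    using that J by (intro integrable_const_bound[where B = 1]) (auto simp: softmax_nonneg softmax_le_1)
  have qP: "q j \<le> ?P j" if j: "j \<in> J" for j
  proof (rule exp_slope_bound_imp_le)
    fix t :: real assume t: "t > 0"
    let ?w = "\<lambda>l. v l + (if l = j then t else 0)"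
    have "(\<Sum>l\<in>J. q l * ?w l) = (\<Sum>l\<in>J. q l * v l + (if l = j then q l * t else 0))"
      by (intro sum.cong) (auto simp: algebra_simps)
    also have "\<dots> = (\<Sum>l\<in>J. q l * v l) + t * q j" using j J by (simp add: sum.distrib)
    finally have "t * q j \<le> (\<integral>x. L ?w x \<partial>M) - (\<integral>x. L v x \<partial>M)"
      using glob[of ?w] unfolding \<Phi>_def by linarith
    also have "\<dots> \<le> (\<integral>x. L v x + softmax J (\<lambda>l. v l - c l x) j * (exp t - 1) \<partial>M) - (\<integral>x. L v x \<partial>M)"
    proof (intro diff_right_mono integral_mono)
      fix x
      have "(\<lambda>l. v l + (if l = j then t else 0) - c l x) = (\<lambda>l. v l - c l x + (if l = j then t else 0))"
        by auto
      thus "L ?w x \<le> L v x + softmax J (\<lambda>l. v l - c l x) j * (exp t - 1)"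
        unfolding L_def using log_sum_exp_perturb[OF J(1) j, of "\<lambda>l. v l - c l x" t] by simp
    qed (use Si[OF j] in auto)
    also have "\<dots> = ?P j * (exp t - 1)" using Si[OF j] by simp
    finally show "t * q j \<le> ?P j * (exp t - 1)" .
  qed
  have "(\<Sum>j\<in>J. ?P j) = (\<integral>x. (\<Sum>j\<in>J. softmax J (\<lambda>l. v l - c l x) j) \<partial>M)"
    using Si by (intro Bochner_Integration.integral_sum[symmetric]) auto
  also have "\<dots> = 1" using J by (simp add: sum_softmax prob_space)
  finally have "(\<Sum>j\<in>J. ?P j - q j) = 0" by (simp add: sum_subtractf q1)
  hence "\<forall>j\<in>J. ?P j - q j = 0" using qP J by (subst (asm) sum_nonneg_eq_0_iff) auto
  thus ?thesis by (intro exI[of _ v]) auto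
qed

section \<open>The quadratic cost and its transforms\<close>

lemma prob_measures_onD:
  assumes "M \<in> prob_measures_on \<Omega>"
  shows "prob_space M" "sets M = sets borel" "space M = UNIV" "emeasure M \<Omega> = 1"
  using assms sets_eq_imp_space_eq[of M borel] by (auto simp: prob_measures_on_def)

lemma AE_prob_measures_on:
  assumes "M \<in> prob_measures_on \<Omega>" "compact \<Omega>"
  shows "AE x in M. x \<in> \<Omega>"
proof -
  note M = prob_measures_onD[OF assms(1)]
  interpret prob_space M by (rule M)
  have "\<Omega> \<in> sets M" using M assms(2) by (simp add: compact_imp_closed)
  moreover have "prob \<Omega> = 1" using M by (simp add: measure_def)
  ultimately show ?thesis by (simp add: prob_eq_1)
qed

lemma prob_measures_on_nonempty: "M \<in> prob_measures_on \<Omega> \<Longrightarrow> \<Omega> \<noteq> {}"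
  by (auto simp: prob_measures_on_def)

lemma set_integrable_continuous_on:
  fixes f :: "'a::euclidean_space \<Rightarrow> real"
  assumes M: "M \<in> prob_measures_on \<Omega>" and "compact \<Omega>" "continuous_on \<Omega> f"
  shows "set_integrable M \<Omega> f"
proof -
  interpret prob_space M by (rule prob_measures_onD[OF M])
  have [measurable]: "(\<lambda>x. indicator \<Omega> x *\<^sub>R f x) \<in> borel_measurable M"
    using borel_measurable_continuous_on_indicator[of \<Omega> f] assms prob_measures_onD[OF M]
    by (simp add: compact_imp_closed cong: measurable_cong_sets)
  have "bounded (f ` \<Omega>)" using assms by (simp add: compact_continuous_image compact_imp_bounded)
  then obtain C where "\<And>x. x \<in> \<Omega> \<Longrightarrow> \<bar>f x\<bar> \<le> C" by (auto simp: bounded_iff)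
  hence "norm (indicator \<Omega> x *\<^sub>R f x) \<le> \<bar>C\<bar>" for x
    by (force simp: indicator_def)
  thus ?thesis unfolding set_integrable_def
    by (intro integrable_const_bound[where B = "\<bar>C\<bar>"] AE_I2) measurable
qed

text \<open>Factor the difference of squares: the difference of the norms is at most
  \<open>norm (y - z)\<close> and their sum at most \<open>2 * D\<close>. Continuity of transforms
  and the quantisation error both rest on this modulus.\<close>

lemma half_square_dist_lipschitz:
  fixes x y z :: "'a::real_normed_vector"
  assumes "norm (x - y) \<le> D" "norm (x - z) \<le> D"
  shows "(norm (x - y))\<^sup>2 / 2 \<le> (norm (x - z))\<^sup>2 / 2 + D * norm (y - z)"
proof -
  have "norm (x - y) - norm (x - z) \<le> norm (y - z)"
    using norm_triangle_ineq3[of "x - y" "x - z"] by (simp add: norm_minus_commute)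
  moreover have "(norm (x - y))\<^sup>2 - (norm (x - z))\<^sup>2
        = (norm (x - y) - norm (x - z)) * (norm (x - y) + norm (x - z))"
    by (simp add: power2_eq_square algebra_simps)
  moreover have "\<dots> \<le> norm (y - z) * (2 * D)"
    using calculation(1) assms by (intro mult_mono) auto
  ultimately show ?thesis by (simp add: algebra_simps)
qed


lemma continuous_on_of_lipschitz:
  fixes f :: "'a::real_normed_vector \<Rightarrow> real"
  assumes "\<And>x y. x \<in> S \<Longrightarrow> y \<in> S \<Longrightarrow> f x \<le> f y + L * norm (x - y)"
  shows "continuous_on S f"
proof -
  have "\<bar>L\<bar>-lipschitz_on S f"
  proof (rule lipschitz_onI)
    fix x y assume xy: "x \<in> S" "y \<in> S"
    have "L * norm (x - y) \<le> \<bar>L\<bar> * norm (x - y)" by (intro mult_right_mono) auto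
    thus "dist (f x) (f y) \<le> \<bar>L\<bar> * dist x y"
      using assms[OF xy] assms[OF xy(2,1)] by (auto simp: dist_norm norm_minus_commute abs_le_iff)
  qed auto
  thus ?thesis by (rule lipschitz_on_continuous_on)
qed

lemma bounded_dist_bound:
  fixes S :: "'a::real_normed_vector set"
  assumes "bounded S"
  obtains D where "D \<ge> 0" "\<And>x y. x \<in> S \<Longrightarrow> y \<in> S \<Longrightarrow> norm (x - y) \<le> D"
proof -
  obtain B where B: "\<And>x. x \<in> S \<Longrightarrow> norm x \<le> B" using assms by (auto simp: bounded_iff)
  have "norm (x - y) \<le> 2 * \<bar>B\<bar>" if "x \<in> S" "y \<in> S" for x y
    using B[OF that(1)] B[OF that(2)] norm_triangle_ineq4[of x y] by linarith
  thus ?thesis by (intro that[of "2 * \<bar>B\<bar>"]) auto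
qed

text \<open>An upper bound \<open>C\<close> of \<phi> bounds the family below by \<open>- C\<close>,
  so the real infimum is a genuine one and lies below each member.\<close>

lemma c_transform_le:
  assumes "bdd_above (\<phi> ` \<Omega>)" "x \<in> \<Omega>"
  shows "\<phi> x + c_transform \<Omega> \<phi> y \<le> (norm (x - y))\<^sup>2 / 2"
proof -
  obtain C where C: "\<And>x. x \<in> \<Omega> \<Longrightarrow> \<phi> x \<le> C" using assms(1) by (auto simp: bdd_above_def)
  have "bdd_below ((\<lambda>x. (norm (x - y))\<^sup>2 / 2 - \<phi> x) ` \<Omega>)"
  proof (rule bdd_belowI2)
    fix x assume "x \<in> \<Omega>"
    thus "- C \<le> (norm (x - y))\<^sup>2 / 2 - \<phi> x"
      using C[of x] zero_le_power2[of "norm (x - y)"] by linarith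
  qed
  from cINF_lower[OF this assms(2)] show ?thesis unfolding c_transform_def by linarith
qed

lemma c_transform_geI:
  assumes "\<Omega> \<noteq> {}" "\<And>x. x \<in> \<Omega> \<Longrightarrow> t + \<phi> x \<le> (norm (x - y))\<^sup>2 / 2"
  shows "t \<le> c_transform \<Omega> \<phi> y"
  unfolding c_transform_def using assms by (intro cINF_greatest) (auto simp: le_diff_eq)

lemma continuous_on_c_transform:
  fixes \<Omega> :: "'a::euclidean_space set"
  assumes "bounded \<Omega>" "bdd_above (\<phi> ` \<Omega>)" "\<Omega> \<noteq> {}"
  shows "continuous_on \<Omega> (c_transform \<Omega> \<phi>)"
proof -
  obtain D where "D \<ge> 0" and D: "\<And>x y. x \<in> \<Omega> \<Longrightarrow> y \<in> \<Omega> \<Longrightarrow> norm (x - y) \<le> D"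
    using bounded_dist_bound[OF assms(1)] by metis
  show ?thesis
  proof (rule continuous_on_of_lipschitz)
    fix y z assume yz: "y \<in> \<Omega>" "z \<in> \<Omega>"
    have "c_transform \<Omega> \<phi> y - D * norm (y - z) \<le> c_transform \<Omega> \<phi> z"
    proof (rule c_transform_geI[OF assms(3)])
      fix x assume x: "x \<in> \<Omega>"
      show "c_transform \<Omega> \<phi> y - D * norm (y - z) + \<phi> x \<le> (norm (x - z))\<^sup>2 / 2"
        using c_transform_le[OF assms(2) x, of y] half_square_dist_lipschitz[OF D[OF x yz(1)] D[OF x yz(2)]]
        by linarith
    qed
    thus "c_transform \<Omega> \<phi> y \<le> c_transform \<Omega> \<phi> z + D * norm (y - z)" by linarith
  qed
qed

text \<open>An infimum over \<open>y\<close> inherits any bound on the cost that is uniform in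
  \<open>y\<close>. With \<open>k\<close> proportional to \<open>norm (x - z)\<close> this gives
  continuity, with constant \<open>k\<close> a bound on the oscillation.\<close>

lemma c_concave_on_diff_le:
  assumes c: "c_concave_on \<Omega> \<phi>" and "x \<in> \<Omega>" "z \<in> \<Omega>"
    and k: "\<And>y. y \<in> \<Omega> \<Longrightarrow> (norm (x - y))\<^sup>2 / 2 \<le> (norm (z - y))\<^sup>2 / 2 + k"
  shows "\<phi> x \<le> \<phi> z + k"
proof -
  obtain \<psi> :: "'a \<Rightarrow> ereal" where \<psi>: "\<And>x. x \<in> \<Omega> \<Longrightarrow>
      ereal (\<phi> x) = (INF y\<in>\<Omega>. ereal ((norm (x - y))\<^sup>2 / 2) - \<psi> y)"
    using c by (auto simp: c_concave_on_def)
  have "ereal (\<phi> x - k) \<le> ereal (\<phi> z)"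
    unfolding \<psi>[OF \<open>z \<in> \<Omega>\<close>]
  proof (rule INF_greatest)
    fix y assume y: "y \<in> \<Omega>"
    have "ereal (\<phi> x) \<le> ereal ((norm (x - y))\<^sup>2 / 2) - \<psi> y"
      unfolding \<psi>[OF \<open>x \<in> \<Omega>\<close>] using y by (rule INF_lower)
    thus "ereal (\<phi> x - k) \<le> ereal ((norm (z - y))\<^sup>2 / 2) - \<psi> y"
      using k[OF y] by (cases "\<psi> y") auto
  qed
  thus ?thesis by simp
qed

lemma continuous_on_c_concave:
  fixes \<Omega> :: "'a::euclidean_space set"
  assumes "bounded \<Omega>" and c: "c_concave_on \<Omega> \<phi>"
  shows "continuous_on \<Omega> \<phi>"
proof -
  obtain D where "D \<ge> 0" and D: "\<And>x y. x \<in> \<Omega> \<Longrightarrow> y \<in> \<Omega> \<Longrightarrow> norm (x - y) \<le> D"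
    using bounded_dist_bound[OF assms(1)] by metis
  show ?thesis
  proof (intro continuous_on_of_lipschitz c_concave_on_diff_le[OF c])
    fix x z y assume "x \<in> \<Omega>" "z \<in> \<Omega>" "y \<in> \<Omega>"
    thus "(norm (x - y))\<^sup>2 / 2 \<le> (norm (z - y))\<^sup>2 / 2 + D * norm (x - z)"
      using half_square_dist_lipschitz[of y x D z] D by (simp add: norm_minus_commute)
  qed
qed

text \<open>Points of \<Omega> are at distance at most \<open>2 * R\<close>, so the cost lies
  between 0 and \<open>2 * R\<^sup>2\<close> and the oscillation of \<phi> is at most
  \<open>2 * R\<^sup>2\<close>. The oscillation bound also makes \<phi> bounded below, so that the
  normalised infimum is attained as a true lower bound.\<close>

lemma c_concave_on_normalized_bounds:
  fixes \<Omega> :: "'a::euclidean_space set"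
  assumes c: "c_concave_on \<Omega> \<phi>" and R: "\<And>x. x \<in> \<Omega> \<Longrightarrow> norm x \<le> R"
    and z: "(INF x\<in>\<Omega>. \<phi> x) = 0" and x: "x \<in> \<Omega>"
  shows "0 \<le> \<phi> x" "\<phi> x \<le> 2 * R\<^sup>2"
proof -
  have osc: "\<phi> x \<le> \<phi> z + 2 * R\<^sup>2" if "x \<in> \<Omega>" "z \<in> \<Omega>" for x z
  proof (rule c_concave_on_diff_le[OF c that])
    fix y assume y: "y \<in> \<Omega>"
    have "norm (x - y) \<le> 2 * R" using R[OF that(1)] R[OF y] norm_triangle_ineq4[of x y] by linarith
    hence "(norm (x - y))\<^sup>2 \<le> (2 * R)\<^sup>2" by (intro power_mono) auto
    hence "(norm (x - y))\<^sup>2 \<le> 4 * R\<^sup>2" by (simp add: power_mult_distrib)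
    moreover have "0 \<le> (norm (z - y))\<^sup>2" by simp
    ultimately show "(norm (x - y))\<^sup>2 / 2 \<le> (norm (z - y))\<^sup>2 / 2 + 2 * R\<^sup>2"
      by linarith
  qed
  have ge: "\<phi> x - 2 * R\<^sup>2 \<le> \<phi> z" if "z \<in> \<Omega>" for z using osc[OF x that] by linarith
  hence "bdd_below (\<phi> ` \<Omega>)" by (rule bdd_belowI2)
  thus "0 \<le> \<phi> x" using cINF_lower[of \<phi> \<Omega> x] x z by simp
  have "\<phi> x - 2 * R\<^sup>2 \<le> (INF z\<in>\<Omega>. \<phi> z)"
    using x ge by (intro cINF_greatest) auto
  thus "\<phi> x \<le> 2 * R\<^sup>2" using z by simp
qed

text \<open>Compactness provides finitely many \<delta>-balls covering \<Omega>; induction over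
  their centres sends each point to the centre of some ball that contains it.\<close>

lemma measurable_quantizer:
  fixes \<Omega> :: "'a::euclidean_space set"
  assumes "compact \<Omega>" "\<Omega> \<noteq> {}" "\<delta> > 0"
  obtains s where "s \<in> borel_measurable borel" "finite (range s)" "range s \<subseteq> \<Omega>"
    "\<And>y. y \<in> \<Omega> \<Longrightarrow> norm (y - s y) \<le> \<delta>"
proof -
  \<comment> \<open>Default value for points in none of the balls; it keeps the range inside
    \<Omega> even for arguments outside \<Omega>.\<close>
  obtain a where a: "a \<in> \<Omega>" using assms by auto
  have step: "\<exists>s. s \<in> borel_measurable borel \<and> range s \<subseteq> insert a F \<and>
      (\<forall>y\<in>(\<Union>x\<in>F. ball x \<delta>). norm (y - s y) \<le> \<delta>)" if "finite F" for F
    using that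
  proof (induction F rule: finite_induct)
    case empty
    show ?case by (intro exI[of _ "\<lambda>_. a"]) auto
  next
    case (insert x F)
    then obtain s where s [measurable]: "s \<in> borel_measurable borel" and s': "range s \<subseteq> insert a F"
      "\<And>y. y \<in> (\<Union>x\<in>F. ball x \<delta>) \<Longrightarrow> norm (y - s y) \<le> \<delta>" by blast
    show ?case
    proof (intro exI[of _ "\<lambda>y. if y \<in> ball x \<delta> then x else s y"] conjI ballI)
      show "(\<lambda>y. if y \<in> ball x \<delta> then x else s y) \<in> borel_measurable borel"
        by (intro measurable_If_set) auto
      fix y assume "y \<in> (\<Union>x\<in>insert x F. ball x \<delta>)"
      thus "norm (y - (if y \<in> ball x \<delta> then x else s y)) \<le> \<delta>"
        using s'(2)[of y] by (auto simp: dist_norm norm_minus_commute)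
    qed (use s'(1) in auto)
  qed
  obtain F where F: "F \<subseteq> \<Omega>" "finite F" "\<Omega> \<subseteq> (\<Union>x\<in>F. ball x \<delta>)"
    by (rule compactE_image[OF assms(1), of \<Omega> "\<lambda>x. ball x \<delta>"]) (use assms(3) in auto)
  obtain s where s: "s \<in> borel_measurable borel" "range s \<subseteq> insert a F"
     "\<forall>y\<in>(\<Union>x\<in>F. ball x \<delta>). norm (y - s y) \<le> \<delta>"
    using step[OF F(2)] by blast
  show ?thesis
  proof (rule that)
    show "finite (range s)" using finite_subset[OF s(2)] F(2) by simp
    show "range s \<subseteq> \<Omega>" using s(2) F(1) a by blast
    show "norm (y - s y) \<le> \<delta>" if "y \<in> \<Omega>" for y using that s(3) F(3) by blast
  qed (rule s)
qed

section \<open>Couplings and Kantorovich duality\<close>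

text \<open>Tonelli's theorem: integrating out one variable leaves the factor 1 almost everywhere,
  so each marginal is the original measure.\<close>

lemma density_in_couplings:
  fixes N M :: "'a::euclidean_space measure"
  assumes N: "prob_space N" "sets N = sets borel" and M: "prob_space M" "sets M = sets borel"
    and h [measurable]: "h \<in> borel_measurable (N \<Otimes>\<^sub>M M)"
    and h1: "AE y in N. (\<integral>\<^sup>+ x. h (y, x) \<partial>M) = 1"
    and h2: "AE x in M. (\<integral>\<^sup>+ y. h (y, x) \<partial>N) = 1"
  shows "density (N \<Otimes>\<^sub>M M) h \<in> couplings N M"
proof -
  interpret N: prob_space N by fact
  interpret M: prob_space M by fact
  interpret P: pair_sigma_finite N M by unfold_locales
  let ?\<pi> = "density (N \<Otimes>\<^sub>M M) h"
  note [measurable_cong] = N(2) M(2)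
  have sp: "space N = UNIV" "space M = UNIV" using sets_eq_imp_space_eq[OF N(2)] sets_eq_imp_space_eq[OF M(2)] by auto
  \<comment> \<open>\<open>couplings\<close> asks for the Borel sets of the product space; by second
    countability they form the product sigma-algebra.\<close>
  have prod: "sets (N \<Otimes>\<^sub>M M) = sets (borel :: ('a \<times> 'a) measure)"
    unfolding sets_pair_measure_cong[OF N(2) M(2)] borel_prod ..
  have 1: "emeasure ?\<pi> (A \<times> UNIV) = emeasure N A" if A [measurable]: "A \<in> sets borel" for A
  proof -
    have [measurable]: "A \<times> UNIV \<in> sets (N \<Otimes>\<^sub>M M)"
      using A N(2) M(2) by (intro pair_measureI) auto
    have "emeasure ?\<pi> (A \<times> UNIV) = (\<integral>\<^sup>+ z. h z * indicator (A \<times> UNIV) z \<partial>(N \<Otimes>\<^sub>M M))"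
      by (subst emeasure_density) simp_all
    also have "\<dots> = (\<integral>\<^sup>+ y. (\<integral>\<^sup>+ x. h (y, x) * indicator (A \<times> UNIV) (y, x) \<partial>M) \<partial>N)"
      by (subst M.nn_integral_fst[symmetric]) simp_all
    also have "\<dots> = (\<integral>\<^sup>+ y. (\<integral>\<^sup>+ x. h (y, x) \<partial>M) * indicator A y \<partial>N)"
      by (intro nn_integral_cong) (auto simp: indicator_def)
    also have "\<dots> = (\<integral>\<^sup>+ y. indicator A y \<partial>N)"
      using h1 by (intro nn_integral_cong_AE) auto
    finally show ?thesis using A N(2) by simp
  qed
  have 2: "emeasure ?\<pi> (UNIV \<times> A) = emeasure M A" if A [measurable]: "A \<in> sets borel" for A
  proof -
    have [measurable]: "UNIV \<times> A \<in> sets (N \<Otimes>\<^sub>M M)"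
      using A N(2) M(2) by (intro pair_measureI) auto
    have "emeasure ?\<pi> (UNIV \<times> A) = (\<integral>\<^sup>+ z. h z * indicator (UNIV \<times> A) z \<partial>(N \<Otimes>\<^sub>M M))"
      by (subst emeasure_density) simp_all
    also have "\<dots> = (\<integral>\<^sup>+ x. (\<integral>\<^sup>+ y. h (y, x) * indicator (UNIV \<times> A) (y, x) \<partial>N) \<partial>M)"
      by (subst P.nn_integral_snd[symmetric]) simp_all
    also have "\<dots> = (\<integral>\<^sup>+ x. (\<integral>\<^sup>+ y. h (y, x) \<partial>N) * indicator A x \<partial>M)"
      by (intro nn_integral_cong) (auto simp: indicator_def)
    also have "\<dots> = (\<integral>\<^sup>+ x. indicator A x \<partial>M)"
      using h2 by (intro nn_integral_cong_AE) auto
    finally show ?thesis using A M(2) by simp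
  qed
  have meas: "fst \<in> measurable ?\<pi> borel" "snd \<in> measurable ?\<pi> borel"
    using measurable_fst[of N M] measurable_snd[of N M]
      measurable_cong_sets[OF _ N(2), of ?\<pi> "N \<Otimes>\<^sub>M M"] measurable_cong_sets[OF _ M(2), of ?\<pi> "N \<Otimes>\<^sub>M M"]
    by simp_all
  have spi: "space ?\<pi> = UNIV" by (simp add: space_pair_measure sp)
  have "emeasure ?\<pi> UNIV = 1" using 1[of UNIV] N.emeasure_space_1 sp by simp
  hence "prob_space ?\<pi>" by (intro prob_spaceI) (simp only: spi)
  moreover have "distr ?\<pi> borel fst = N"
  proof (rule measure_eqI)
    fix A assume "A \<in> sets (distr ?\<pi> borel fst)"
    hence A: "A \<in> sets borel" by simp
    have "fst -` A \<inter> space ?\<pi> = A \<times> UNIV" using spi by auto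
    thus "emeasure (distr ?\<pi> borel fst) A = emeasure N A"
      using emeasure_distr[OF meas(1) A] 1[OF A] by simp
  qed (simp add: N)
  moreover have "distr ?\<pi> borel snd = M"
  proof (rule measure_eqI)
    fix A assume "A \<in> sets (distr ?\<pi> borel snd)"
    hence A: "A \<in> sets borel" by simp
    have "snd -` A \<inter> space ?\<pi> = UNIV \<times> A" using spi by auto
    thus "emeasure (distr ?\<pi> borel snd) A = emeasure M A"
      using emeasure_distr[OF meas(2) A] 2[OF A] by simp
  qed (simp add: M)
  ultimately show ?thesis using prod by (simp add: couplings_def)
qed

lemma couplings_marginals:
  fixes f :: "'a::euclidean_space \<Rightarrow> real"
  assumes \<pi>: "\<pi> \<in> couplings N M"
  shows couplings_AE_fst: "AE y in N. P y \<Longrightarrow> AE z in \<pi>. P (fst z)"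
    and couplings_AE_snd: "AE x in M. P x \<Longrightarrow> AE z in \<pi>. P (snd z)"
    and couplings_integrable_fst: "integrable N f \<Longrightarrow> integrable \<pi> (\<lambda>z. f (fst z))"
    and couplings_integrable_snd: "integrable M f \<Longrightarrow> integrable \<pi> (\<lambda>z. f (snd z))"
    and couplings_integral_fst: "integrable N f \<Longrightarrow> (\<integral>z. f (fst z) \<partial>\<pi>) = (\<integral>y. f y \<partial>N)"
    and couplings_integral_snd: "integrable M f \<Longrightarrow> (\<integral>z. f (snd z) \<partial>\<pi>) = (\<integral>x. f x \<partial>M)"
proof -
  have \<pi>': "sets \<pi> = sets borel" "N = distr \<pi> borel fst" "M = distr \<pi> borel snd"
    using \<pi> by (auto simp: couplings_def)
  have m: "fst \<in> measurable \<pi> borel" "snd \<in> measurable \<pi> borel"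
    by (simp_all add: \<pi>'(1) borel_measurable_continuous_onI continuous_on_fst continuous_on_snd continuous_on_id cong: measurable_cong_sets)
  show "AE y in N. P y \<Longrightarrow> AE z in \<pi>. P (fst z)"
    unfolding \<pi>'(2) by (rule AE_distrD[OF m(1)])
  show "AE x in M. P x \<Longrightarrow> AE z in \<pi>. P (snd z)"
    unfolding \<pi>'(3) by (rule AE_distrD[OF m(2)])
  show i1: "integrable \<pi> (\<lambda>z. f (fst z))" if "integrable N f"
    using that unfolding \<pi>'(2) by (rule integrable_distr[OF m(1)])
  show i2: "integrable \<pi> (\<lambda>z. f (snd z))" if "integrable M f"
    using that unfolding \<pi>'(3) by (rule integrable_distr[OF m(2)])
  show "(\<integral>z. f (fst z) \<partial>\<pi>) = (\<integral>y. f y \<partial>N)" if "integrable N f"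
    using borel_measurable_integrable[OF that] unfolding \<pi>'(2) by (subst integral_distr[OF m(1)]) simp_all
  show "(\<integral>z. f (snd z) \<partial>\<pi>) = (\<integral>y. f y \<partial>M)" if "integrable M f"
    using borel_measurable_integrable[OF that] unfolding \<pi>'(3) by (subst integral_distr[OF m(2)]) simp_all
qed

text \<open>Weak duality: integrate the pointwise inequality for \<phi> and its transform against
  \<pi>. The potential lives on the second marginal, matching the order of arguments of
  \<open>W2\<close> in \<open>barycenter_energy\<close>.\<close>

lemma dual_objective_le_coupling_cost:
  fixes \<Omega> :: "'a::euclidean_space set"
  assumes \<Omega>: "compact \<Omega>" and N: "N \<in> prob_measures_on \<Omega>" and M: "M \<in> prob_measures_on \<Omega>"
    and \<phi>: "continuous_on \<Omega> \<phi>" and \<pi>: "\<pi> \<in> couplings N M"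
  shows "ennreal (2 * dual_objective \<Omega> M N \<phi>) \<le> (\<integral>\<^sup>+ (y, x). ennreal ((norm (y - x))\<^sup>2) \<partial>\<pi>)"
proof -
  note ne = prob_measures_on_nonempty[OF M]
  have bdd: "bdd_above (\<phi> ` \<Omega>)"
    using \<Omega> \<phi> by (intro bounded_imp_bdd_above compact_imp_bounded compact_continuous_image)
  define f where "f = (\<lambda>x. indicator \<Omega> x *\<^sub>R \<phi> x)"
  define g where "g = (\<lambda>y. indicator \<Omega> y *\<^sub>R c_transform \<Omega> \<phi> y)"
  have f: "integrable M f" using set_integrable_continuous_on[OF M \<Omega> \<phi>] by (simp add: f_def set_integrable_def)
  have g: "integrable N g"
    using set_integrable_continuous_on[OF N \<Omega> continuous_on_c_transform[OF compact_imp_bounded[OF \<Omega>] bdd ne]]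
    by (simp add: g_def set_integrable_def)
  have "2 * dual_objective \<Omega> M N \<phi> = (\<integral>z. 2 * (g (fst z) + f (snd z)) \<partial>\<pi>)"
    using couplings_integral_fst[OF \<pi> g] couplings_integral_snd[OF \<pi> f]
      couplings_integrable_fst[OF \<pi> g] couplings_integrable_snd[OF \<pi> f]
    unfolding dual_objective_def set_lebesgue_integral_def f_def[symmetric] g_def[symmetric] by simp
  \<comment> \<open>The positive part is needed to pass from the Bochner integral to the nonnegative
    one.\<close>
  also have "ennreal \<dots> \<le> ennreal (\<integral>z. max 0 (2 * (g (fst z) + f (snd z))) \<partial>\<pi>)"
    using couplings_integrable_fst[OF \<pi> g] couplings_integrable_snd[OF \<pi> f]
    by (intro ennreal_leI integral_mono) auto
  also have "\<dots> = (\<integral>\<^sup>+ z. ennreal (max 0 (2 * (g (fst z) + f (snd z)))) \<partial>\<pi>)"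
    using couplings_integrable_fst[OF \<pi> g] couplings_integrable_snd[OF \<pi> f]
    by (subst nn_integral_eq_integral) auto
  also have "\<dots> \<le> (\<integral>\<^sup>+ (y, x). ennreal ((norm (y - x))\<^sup>2) \<partial>\<pi>)"
  proof (rule nn_integral_mono_AE)
    show "AE z in \<pi>. ennreal (max 0 (2 * (g (fst z) + f (snd z)))) \<le>
        (case z of (y, x) \<Rightarrow> ennreal ((norm (y - x))\<^sup>2))"
      using couplings_AE_fst[OF \<pi> AE_prob_measures_on[OF N \<Omega>]]
        couplings_AE_snd[OF \<pi> AE_prob_measures_on[OF M \<Omega>]]
    proof eventually_elim
      case (elim z)
      have "\<phi> (snd z) + c_transform \<Omega> \<phi> (fst z) \<le> (norm (snd z - fst z))\<^sup>2 / 2"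
        by (rule c_transform_le[OF bdd elim(2)])
      hence "max 0 (2 * (g (fst z) + f (snd z))) \<le> (norm (fst z - snd z))\<^sup>2"
        using elim by (simp add: f_def g_def norm_minus_commute)
      thus ?case by (simp add: case_prod_beta ennreal_leI)
    qed
  qed
  finally show ?thesis .
qed

text \<open>Used to choose tolerances \<delta> and \<epsilon>: the \<open>+ 1\<close> keeps them
  positive even when the constant to be absorbed is 0.\<close>

lemma mult_divide_plus_one_le:
  fixes t r :: real
  assumes "0 \<le> t" "0 \<le> r"
  shows "r * (t / (r + 1)) \<le> t"
  using assms by (simp add: pos_divide_le_eq algebra_simps)

text \<open>
  With \<open>s\<close> a quantiser of mesh \<open>\<delta>\<close> and \<open>K x j = exp (v j - c j x + u x / \<epsilon>)\<close> the soft assignment, the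
  coupling has density \<open>K x (s y) / q (s y)\<close>. As \<open>K \<le> 1\<close>, the pair \<open>(u, \<epsilon> v)\<close> is dual feasible, and
  \<open>- ln K \<le> 1 / K\<close> bounds the duality gap by \<open>\<epsilon> * (\<Sum>j. 1 / q j)\<close>; thus \<open>\<delta>\<close> has to be chosen before \<open>\<epsilon>\<close>.
\<close>
theorem approximate_kantorovich_duality:
  fixes \<Omega> :: "'a::euclidean_space set"
  assumes \<Omega>: "compact \<Omega>" and N: "N \<in> prob_measures_on \<Omega>" and M: "M \<in> prob_measures_on \<Omega>"
    and e: "e > 0"
  obtains \<pi> u where "\<pi> \<in> couplings N M" "continuous_on \<Omega> u"
    "(\<integral>\<^sup>+ (y, x). ennreal ((norm (y - x))\<^sup>2) \<partial>\<pi>) \<le> ennreal (2 * dual_objective \<Omega> M N u + e)"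
proof -
  note N' = prob_measures_onD[OF N] and M' = prob_measures_onD[OF M]
  interpret N: prob_space N by (rule N')
  interpret M: prob_space M by (rule M')
  interpret P: pair_prob_space N M ..
  have mM: "borel_measurable M = (borel_measurable borel :: ('a \<Rightarrow> real) set)"
    by (rule measurable_cong_sets[OF M'(2) refl])
  note ne = prob_measures_on_nonempty[OF M]

  \<comment> \<open>Quantisation of the first marginal\<close>
  obtain D where D: "D \<ge> 0" "\<And>x y. x \<in> \<Omega> \<Longrightarrow> y \<in> \<Omega> \<Longrightarrow> norm (x - y) \<le> D"
    using bounded_dist_bound[OF compact_imp_bounded[OF \<Omega>]] by metis
  define \<delta> where "\<delta> = e / 8 / (D + 1)"
  have \<delta>: "\<delta> > 0" using e D by (simp add: \<delta>_def)
  have D\<delta>: "D * \<delta> \<le> e / 8"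
    unfolding \<delta>_def by (rule mult_divide_plus_one_le) (use e D in auto)
  obtain s where s [measurable]: "s \<in> borel_measurable borel" and s': "finite (range s)" "range s \<subseteq> \<Omega>"
    "\<And>y. y \<in> \<Omega> \<Longrightarrow> norm (y - s y) \<le> \<delta>"
    using measurable_quantizer[OF \<Omega> ne \<delta>] by metis
  define A where "A = (\<lambda>j. s -` {j})"
  have A: "A j \<in> sets borel" for j
    unfolding A_def using measurable_sets[OF s, of "{j}"] by simp
  have AN [measurable]: "A j \<in> sets N" for j using A N'(2) by simp
  define q where "q = (\<lambda>j. measure N (A j))"
  \<comment> \<open>Cells of mass 0 are dropped: the soft assignment needs positive weights and the
    coupling density divides by them.\<close>
  define J where "J = {j \<in> range s. q j > 0}"
  have J: "finite J" "J \<subseteq> \<Omega>" "\<And>j. j \<in> J \<Longrightarrow> q j > 0"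
    using s'(1,2) by (auto simp: J_def intro: finite_subset[OF _ s'(1)])
  have sJ: "AE y in N. s y \<in> J"
  proof -
    have "AE y in N. \<forall>j\<in>range s - J. y \<notin> A j"
    proof (rule AE_finite_allI)
      fix j assume "j \<in> range s - J"
      hence "measure N (A j) = 0" using measure_nonneg[of N "A j"] by (auto simp: J_def q_def)
      thus "AE y in N. y \<notin> A j" using AN by (simp add: N.prob_eq_0)
    qed (use s' in simp)
    thus ?thesis by eventually_elim (auto simp: A_def)
  qed
  have q1: "(\<Sum>j\<in>J. q j) = 1"
  proof -
    have "(\<Sum>j\<in>J. q j) = measure N (\<Union>j\<in>J. A j)"
      unfolding q_def using J AN
      by (subst N.finite_measure_finite_Union) (auto simp: disjoint_family_on_def A_def)
    also have "\<dots> = 1"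
    proof (subst N.prob_eq_1)
      show "(\<Union>j\<in>J. A j) \<in> sets N" using J AN by auto
      show "AE y in N. y \<in> (\<Union>j\<in>J. A j)" using sJ by eventually_elim (auto simp: A_def)
    qed
    finally show ?thesis .
  qed
  hence Jne: "J \<noteq> {}" by auto
  \<comment> \<open>Writing \<open>F (s y)\<close> as a finite sum over cells makes measurability
    and integration over \<open>N\<close> elementary.\<close>
  have delta: "(\<Sum>j\<in>J. F j * indicator (A j) y) = (F (s y) :: real)" if "s y \<in> J" for F y
  proof -
    have "(\<Sum>j\<in>J. F j * indicator (A j) y) = (\<Sum>j\<in>J. if j = s y then F j else 0)"
      by (intro sum.cong) (auto simp: A_def)
    thus ?thesis using that J by simp
  qed
  have delta0: "(\<Sum>j\<in>J. F j * indicator (A j) y) = (0 :: real)" if "s y \<notin> J" for F y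
    using that by (intro sum.neutral) (auto simp: A_def indicator_def)
  define C where "C = (\<Sum>j\<in>J. 1 / q j)"
  have C: "C \<ge> 0" "1 / q j \<le> C" if "j \<in> J" for j
    unfolding C_def using J that
    by (auto intro!: sum_nonneg member_le_sum[where f = "\<lambda>j. 1 / q j"] simp: less_imp_le)
  have C0: "C \<ge> 0" using C(1) Jne by blast

  \<comment> \<open>Entropic regularisation\<close>
  define \<epsilon> where "\<epsilon> = e / 8 / (C + 1)"
  have \<epsilon>: "\<epsilon> > 0" using e C0 by (simp add: \<epsilon>_def)
  have \<epsilon>C: "\<epsilon> * C \<le> e / 8"
    unfolding \<epsilon>_def mult.commute[of _ C] by (rule mult_divide_plus_one_le) (use e C0 in auto)
  define c where "c = (\<lambda>j (x::'a). (norm (x - j))\<^sup>2 / 2 / \<epsilon>)"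
  have cm [measurable]: "c j \<in> borel_measurable M" for j unfolding c_def mM by measurable
  have cb: "AE x in M. 0 \<le> c j x \<and> c j x \<le> D\<^sup>2 / 2 / \<epsilon>" if "j \<in> J" for j
    using AE_prob_measures_on[OF M \<Omega>]
  proof eventually_elim
    case (elim x)
    have "(norm (x - j))\<^sup>2 \<le> D\<^sup>2" using D elim J that by (intro power_mono) auto
    thus ?case using \<epsilon> by (simp add: c_def divide_right_mono)
  qed
  obtain v where v: "\<forall>j\<in>J. (\<integral>x. softmax J (\<lambda>l. v l - c l x) j \<partial>M) = q j"
    using soft_assignment[OF M'(1) J(1) Jne cm cb J(3) q1] ..
  define K where "K = (\<lambda>x. softmax J (\<lambda>l. v l - c l x))"
  \<comment> \<open>A soft minimum over \<open>j\<close> of the cost from \<open>x\<close> to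
    \<open>j\<close> minus \<open>\<epsilon> * v j\<close>, that is, a smoothed transform of
    \<open>\<epsilon> * v\<close>.\<close>
  define u where "u = (\<lambda>x. - \<epsilon> * log_sum_exp J (\<lambda>l. v l - c l x))"
  have Km [measurable]: "(\<lambda>x. K x j) \<in> borel_measurable M" for j
    unfolding K_def softmax_def by measurable
  have Kexp: "K x j = exp (v j - c j x + u x / \<epsilon>)" for x j
    using \<epsilon> J Jne by (simp add: K_def u_def softmax_eq)
  have K0: "K x j > 0" for x j by (simp add: Kexp)
  have K1: "K x j \<le> 1" if "j \<in> J" for x j using that J by (simp add: K_def softmax_le_1)
  \<comment> \<open>Solving the formula for \<open>K\<close> for the cost serves both sides of
    duality: \<open>K \<le> 1\<close> makes the last term nonnegative, and an upper bound on
    \<open>- ln K\<close> controls the gap.\<close>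
  have cost: "(norm (x - j))\<^sup>2 / 2 = \<epsilon> * v j + u x - \<epsilon> * ln (K x j)" for x j
    using \<epsilon> by (simp add: Kexp c_def field_simps)
  have KM: "integrable M (\<lambda>x. K x j)" if "j \<in> J" for j
    using that K1[OF that] K0[of _ j] by (intro M.integrable_const_bound[where B = 1]) (auto simp: less_imp_le)
  have Kint: "(\<integral>x. K x j \<partial>M) = q j" if "j \<in> J" for j using v that by (simp add: K_def)
  have nz: "(\<Sum>l\<in>J. exp (t l)) \<noteq> (0::real)" for t
    by (rule less_imp_neq[THEN not_sym]) (rule sum_exp_pos[OF J(1) Jne])
  have ucont: "continuous_on \<Omega> u"
    unfolding u_def log_sum_exp_def c_def by (intro continuous_intros ballI nz) (use \<epsilon> in simp_all)

  \<comment> \<open>The coupling and its cost\<close>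
  define h where "h = (\<lambda>z. \<Sum>j\<in>J. K (snd z) j / q j * indicator (A j) (fst z))"
  define \<pi> where "\<pi> = density (N \<Otimes>\<^sub>M M) (\<lambda>z. ennreal (h z))"
  have hm [measurable]: "h \<in> borel_measurable (N \<Otimes>\<^sub>M M)"
    unfolding h_def by measurable
  have \<pi>: "\<pi> \<in> couplings N M"
    unfolding \<pi>_def
  proof (rule density_in_couplings[OF N'(1,2) M'(1,2)])
    show "AE y in N. (\<integral>\<^sup>+ x. ennreal (h (y, x)) \<partial>M) = 1"
      using sJ
    proof eventually_elim
      case (elim y)
      have "(\<integral>\<^sup>+ x. ennreal (h (y, x)) \<partial>M) = (\<integral>\<^sup>+ x. ennreal (K x (s y) / q (s y)) \<partial>M)"
        unfolding h_def fst_conv snd_conv delta[OF elim] ..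
      also have "\<dots> = ennreal (\<integral>x. K x (s y) / q (s y) \<partial>M)"
        using K0 J(3)[OF elim] KM[OF elim] by (intro nn_integral_eq_integral) (auto simp: less_imp_le)
      also have "\<dots> = 1" using Kint[OF elim] J(3)[OF elim] by simp
      finally show ?case .
    qed
    \<comment> \<open>The mass \<open>q j\<close> of each cell cancels the denominator, leaving the
      sum of the softmax weights. The other marginal was correct by the choice of
      \<open>v\<close>.\<close>
    show "AE x in M. (\<integral>\<^sup>+ y. ennreal (h (y, x)) \<partial>N) = 1"
    proof (rule AE_I2)
      fix x
      have i: "integrable N (\<lambda>y. K x j / q j * indicator (A j) y)" for j
        using AN by (intro integrable_mult_right integrable_real_indicator) (auto simp: N.emeasure_finite less_top[symmetric])
      have "(\<integral>\<^sup>+ y. ennreal (h (y, x)) \<partial>N) = ennreal (\<integral>y. h (y, x) \<partial>N)"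
        unfolding h_def fst_conv snd_conv using K0 J(3)
        by (intro nn_integral_eq_integral Bochner_Integration.integrable_sum i AE_I2 sum_nonneg)
           (auto simp: less_imp_le)
      also have "(\<integral>y. h (y, x) \<partial>N) = (\<Sum>j\<in>J. K x j / q j * q j)"
        unfolding h_def fst_conv snd_conv using AN N'(3)
        by (subst Bochner_Integration.integral_sum[OF i]) (simp add: q_def)
      also have "\<dots> = (\<Sum>j\<in>J. K x j)" by (intro sum.cong refl) (use J(3) in force)
      also have "\<dots> = 1" using J Jne by (simp add: K_def sum_softmax)
      finally show "(\<integral>\<^sup>+ y. ennreal (h (y, x)) \<partial>N) = 1" by simp
    qed
  qed measurable
  interpret \<pi>: prob_space \<pi> using \<pi> by (simp add: couplings_def)
  \<comment> \<open>\<open>G\<close> is \<open>1 / K\<close> at the cell of \<open>y\<close>. Under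
    \<pi> the factor \<open>K\<close> of the density cancels, leaving
    \<open>1 / q (s y) \<le> C\<close>; so the mean of \<open>G\<close> is bounded independently of
    \<epsilon>, however small \<open>K\<close> becomes.\<close>
  define G where "G = (\<lambda>z. \<Sum>j\<in>J. 1 / K (snd z) j * indicator (A j) (fst z))"
  have Gm [measurable]: "G \<in> borel_measurable (N \<Otimes>\<^sub>M M)"
    unfolding G_def by measurable
  have G0: "G z \<ge> 0" for z unfolding G_def using K0 by (intro sum_nonneg) (auto simp: less_imp_le)
  have GC: "(\<integral>\<^sup>+ z. ennreal (G z) \<partial>\<pi>) \<le> ennreal C"
  proof -
    have "(\<integral>\<^sup>+ z. ennreal (G z) \<partial>\<pi>) = (\<integral>\<^sup>+ z. ennreal (h z) * ennreal (G z) \<partial>(N \<Otimes>\<^sub>M M))"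
      unfolding \<pi>_def by (intro nn_integral_density) measurable
    also have "\<dots> \<le> (\<integral>\<^sup>+ z. ennreal C \<partial>(N \<Otimes>\<^sub>M M))"
    proof (intro nn_integral_mono)
      fix z
      have "h z * G z \<le> C"
      proof (cases "s (fst z) \<in> J")
        case True
        show ?thesis using C(2)[OF True] K0[of "snd z" "s (fst z)"] unfolding h_def G_def delta[OF True] by simp
      next
        case False
        show ?thesis using C0 unfolding h_def G_def delta0[OF False] by simp
      qed
      thus "ennreal (h z) * ennreal (G z) \<le> ennreal C"
        using G0[of z] by (simp add: ennreal_mult''[symmetric] ennreal_leI)
    qed
    also have "\<dots> = ennreal C" by (simp add: P.emeasure_space_1)
    finally show ?thesis .
  qed
  have Gi: "integrable \<pi> G"
  proof (rule integrableI_nonneg)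
    show "G \<in> borel_measurable \<pi>" unfolding \<pi>_def by measurable
    show "(\<integral>\<^sup>+ z. ennreal (G z) \<partial>\<pi>) < \<infinity>" using GC by (simp add: order_le_less_trans)
  qed (use G0 in auto)
  have GC': "(\<integral>z. G z \<partial>\<pi>) \<le> C"
    using GC C0 G0 by (subst (asm) nn_integral_eq_integral[OF Gi]) auto
  define f where "f = (\<lambda>x. indicator \<Omega> x *\<^sub>R u x)"
  define g where "g = (\<lambda>y. indicator \<Omega> y *\<^sub>R c_transform \<Omega> u y)"
  define V where "V = (\<lambda>y. \<Sum>j\<in>J. v j * indicator (A j) y)"
  have bdd: "bdd_above (u ` \<Omega>)"
    using \<Omega> ucont by (intro bounded_imp_bdd_above compact_imp_bounded compact_continuous_image)
  have f: "integrable M f" using set_integrable_continuous_on[OF M \<Omega> ucont] by (simp add: f_def set_integrable_def)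
  have g: "integrable N g"
    using set_integrable_continuous_on[OF N \<Omega> continuous_on_c_transform[OF compact_imp_bounded[OF \<Omega>] bdd ne]]
    by (simp add: g_def set_integrable_def)
  have V: "integrable N V" unfolding V_def
    using AN by (intro Bochner_Integration.integrable_sum integrable_mult_right integrable_real_indicator)
      (auto simp: N.emeasure_finite less_top[symmetric])
  have shift: "(norm (x - y))\<^sup>2 / 2 \<le> (norm (x - s y))\<^sup>2 / 2 + D * \<delta>"
    "(norm (x - s y))\<^sup>2 / 2 \<le> (norm (x - y))\<^sup>2 / 2 + D * \<delta>" if "x \<in> \<Omega>" "y \<in> \<Omega>" for x y
  proof -
    have "s y \<in> \<Omega>" using s' by auto
    moreover have "D * norm (y - s y) \<le> D * \<delta>" using D s'(3)[OF that(2)] by (intro mult_left_mono) auto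
    ultimately show "(norm (x - y))\<^sup>2 / 2 \<le> (norm (x - s y))\<^sup>2 / 2 + D * \<delta>"
      "(norm (x - s y))\<^sup>2 / 2 \<le> (norm (x - y))\<^sup>2 / 2 + D * \<delta>"
      using half_square_dist_lipschitz[of x y D "s y"] half_square_dist_lipschitz[of x "s y" D y] D that
      by (auto simp: norm_minus_commute)
  qed
  \<comment> \<open>The true transform of \<open>u\<close> dominates
    \<open>\<epsilon> * v (s y)\<close> up to the quantisation error, so \<open>v\<close> can be
    replaced by \<open>c_transform \<Omega> u\<close> in the dual value.\<close>
  have gV: "\<epsilon> * (\<integral>y. V y \<partial>N) - D * \<delta> \<le> (\<integral>y. g y \<partial>N)"
  proof -
    have "(\<integral>y. \<epsilon> * V y - D * \<delta> \<partial>N) \<le> (\<integral>y. g y \<partial>N)"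
    proof (rule integral_mono_AE)
      show "AE y in N. \<epsilon> * V y - D * \<delta> \<le> g y"
        using sJ AE_prob_measures_on[OF N \<Omega>]
      proof eventually_elim
        case (elim y)
        have "\<epsilon> * v (s y) - D * \<delta> \<le> c_transform \<Omega> u y"
        proof (rule c_transform_geI[OF ne])
          fix x assume x: "x \<in> \<Omega>"
          have "ln (K x (s y)) \<le> 0" using K1[OF elim(1), of x] K0[of x "s y"] by simp
          hence "\<epsilon> * ln (K x (s y)) \<le> 0" using \<epsilon> by (simp add: mult_le_0_iff)
          thus "\<epsilon> * v (s y) - D * \<delta> + u x \<le> (norm (x - y))\<^sup>2 / 2"
            using cost[of x "s y"] shift(2)[OF x elim(2)] by linarith
        qed
        thus ?case using elim by (simp add: g_def V_def delta)
      qed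
    qed (use V g in auto)
    thus ?thesis using V by (simp add: N.prob_space)
  qed
  note ints = couplings_integrable_snd[OF \<pi> f] couplings_integrable_fst[OF \<pi> V] Gi
  \<comment> \<open>An integrable majorant of the squared distance; the factor 2 undoes the halving
    in the cost.\<close>
  define H where "H = (\<lambda>z. 2 * (f (snd z) + \<epsilon> * V (fst z) + D * \<delta> + \<epsilon> * G z))"
  have Hi: "integrable \<pi> H" unfolding H_def using ints by auto
  have costH: "AE z in \<pi>. (norm (fst z - snd z))\<^sup>2 \<le> H z"
    using couplings_AE_fst[OF \<pi> AE_prob_measures_on[OF N \<Omega>]] couplings_AE_fst[OF \<pi> sJ]
      couplings_AE_snd[OF \<pi> AE_prob_measures_on[OF M \<Omega>]]
  proof eventually_elim
    case (elim z)
    define x y where "x = snd z" and "y = fst z"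
    have "ln (1 / K x (s y)) \<le> 1 / K x (s y)" using ln_le_minus_one[of "1 / K x (s y)"] K0[of x "s y"] by simp
    hence "- ln (K x (s y)) \<le> 1 / K x (s y)" using K0[of x "s y"] by (simp add: ln_div)
    hence "\<epsilon> * (- ln (K x (s y))) \<le> \<epsilon> * (1 / K x (s y))" using \<epsilon> by (intro mult_left_mono) auto
    moreover have "(norm (x - y))\<^sup>2 / 2 \<le> (norm (x - s y))\<^sup>2 / 2 + D * \<delta>"
      using shift(1) elim unfolding x_def y_def by blast
    ultimately have "(norm (x - y))\<^sup>2 \<le> 2 * (u x + \<epsilon> * v (s y) + D * \<delta> + \<epsilon> * (1 / K x (s y)))"
      using cost[of x "s y"] by (simp add: distrib_left right_diff_distrib)
    moreover have "G z = 1 / K x (s y)" "V y = v (s y)" "f x = u x"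
      using elim unfolding G_def V_def f_def x_def y_def by (simp_all only: delta indicator_simps) simp
    ultimately show ?case unfolding H_def x_def[symmetric] y_def[symmetric] by (simp add: norm_minus_commute)
  qed
  have "(\<integral>\<^sup>+ (y, x). ennreal ((norm (y - x))\<^sup>2) \<partial>\<pi>) \<le> (\<integral>\<^sup>+ z. ennreal (H z) \<partial>\<pi>)"
    using costH by (intro nn_integral_mono_AE) (auto elim!: eventually_mono simp: case_prod_beta intro: ennreal_leI)
  also have "\<dots> = ennreal (\<integral>z. H z \<partial>\<pi>)"
    using costH by (intro nn_integral_eq_integral Hi) (auto elim!: eventually_mono intro: order_trans[OF zero_le_power2])
  also have "(\<integral>z. H z \<partial>\<pi>) = 2 * ((\<integral>x. f x \<partial>M) + \<epsilon> * (\<integral>y. V y \<partial>N) + D * \<delta> + \<epsilon> * (\<integral>z. G z \<partial>\<pi>))"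
    unfolding H_def using ints couplings_integral_snd[OF \<pi> f] couplings_integral_fst[OF \<pi> V]
    by (simp add: \<pi>.prob_space)
  \<comment> \<open>Two quantisation errors and one entropic error, each at most
    \<open>e / 8\<close>, are doubled: the total is at most \<open>3 * e / 4\<close>.\<close>
  also have "\<dots> \<le> 2 * dual_objective \<Omega> M N u + e"
  proof -
    have "dual_objective \<Omega> M N u = (\<integral>x. f x \<partial>M) + (\<integral>y. g y \<partial>N)"
      by (simp add: dual_objective_def set_lebesgue_integral_def f_def g_def)
    moreover have "\<epsilon> * (\<integral>z. G z \<partial>\<pi>) \<le> \<epsilon> * C" using \<epsilon> GC' by (intro mult_left_mono) auto
    ultimately show ?thesis using gV D\<delta> \<epsilon>C e by (simp add: algebra_simps)
  qed
  finally have "(\<integral>\<^sup>+ (y, x). ennreal ((norm (y - x))\<^sup>2) \<partial>\<pi>) \<le> ennreal (2 * dual_objective \<Omega> M N u + e)"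
    by (simp add: ennreal_leI)
  thus ?thesis using that \<pi> ucont by blast
qed

section \<open>Passage to the Wasserstein distance\<close>

lemma W2_square_le:
  assumes "\<pi> \<in> couplings N M" "(\<integral>\<^sup>+ (y, x). ennreal ((norm (y - x))\<^sup>2) \<partial>\<pi>) \<le> ennreal r" "0 \<le> r"
  shows "(W2 N M)\<^sup>2 \<le> r"
proof -
  have "(INF \<pi>\<in>couplings N M. \<integral>\<^sup>+ (x, y). ennreal ((norm (x - y))\<^sup>2) \<partial>\<pi>) \<le> ennreal r"
    using assms by (intro INF_lower2)
  thus ?thesis using assms(3) by (simp add: W2_def enn2real_leI)
qed

text \<open>Weak duality holds for every coupling, hence for the infimum. As \<open>enn2real\<close>
  maps infinity to 0, the infimum must first be shown finite; the coupling from approximate duality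
  with error 1 does this.\<close>

lemma dual_objective_le_W2:
  fixes \<Omega> :: "'a::euclidean_space set"
  assumes \<Omega>: "compact \<Omega>" and N: "N \<in> prob_measures_on \<Omega>" and M: "M \<in> prob_measures_on \<Omega>"
    and \<phi>: "continuous_on \<Omega> \<phi>"
  shows "dual_objective \<Omega> M N \<phi> \<le> (W2 N M)\<^sup>2 / 2"
proof -
  let ?I = "INF \<pi>\<in>couplings N M. \<integral>\<^sup>+ (x, y). ennreal ((norm (x - y))\<^sup>2) \<partial>\<pi>"
  obtain \<pi> u where \<pi>: "\<pi> \<in> couplings N M" "continuous_on \<Omega> u"
    "(\<integral>\<^sup>+ (y, x). ennreal ((norm (y - x))\<^sup>2) \<partial>\<pi>) \<le> ennreal (2 * dual_objective \<Omega> M N u + 1)"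
    by (rule approximate_kantorovich_duality[OF \<Omega> N M zero_less_one])
  have "?I \<le> ennreal (2 * dual_objective \<Omega> M N u + 1)"
    using \<pi> by (intro INF_lower2)
  hence fin: "?I < \<top>" by (simp add: order_le_less_trans)
  have "ennreal (2 * dual_objective \<Omega> M N \<phi>) \<le> ?I"
    by (intro INF_greatest dual_objective_le_coupling_cost[OF \<Omega> N M \<phi>])
  from enn2real_mono[OF this fin] have "2 * dual_objective \<Omega> M N \<phi> \<le> enn2real ?I"
    by (cases "0 \<le> 2 * dual_objective \<Omega> M N \<phi>") (auto intro: order_trans[OF _ enn2real_nonneg])
  thus ?thesis by (simp add: W2_def)
qed

text \<open>A maximiser does at least as well as the near-optimal \<open>u\<close> of approximate
  duality for every error \<open>e\<close>; let \<open>e\<close> tend to 0. Comparison with the zero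
  potential shows that the optimal value is nonnegative, so \<open>ennreal\<close> does not truncate
  it.\<close>

lemma kantorovich_potential_W2:
  fixes \<Omega> :: "'a::euclidean_space set"
  assumes \<Omega>: "compact \<Omega>" and N: "N \<in> prob_measures_on \<Omega>" and M: "M \<in> prob_measures_on \<Omega>"
    and \<phi>: "kantorovich_potential \<Omega> M N \<phi>"
  shows "(W2 N M)\<^sup>2 / 2 \<le> dual_objective \<Omega> M N \<phi>"
proof -
  have max: "dual_objective \<Omega> M N u \<le> dual_objective \<Omega> M N \<phi>" if u: "continuous_on \<Omega> u" for u
  proof -
    have "bdd_above (u ` \<Omega>)"
      using \<Omega> u by (intro bounded_imp_bdd_above compact_imp_bounded compact_continuous_image)
    hence "dual_admissible \<Omega> M u"
      using set_integrable_continuous_on[OF M \<Omega> u] by (simp add: dual_admissible_def)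
    thus ?thesis using \<phi> by (auto simp: kantorovich_potential_def is_arg_max_def not_less)
  qed
  have "0 \<le> c_transform \<Omega> (\<lambda>_. 0) y" for y
    by (rule c_transform_geI[OF prob_measures_on_nonempty[OF M]]) simp
  hence "0 \<le> dual_objective \<Omega> M N (\<lambda>_. 0)"
    by (auto simp: dual_objective_def set_lebesgue_integral_def intro!: integral_nonneg)
  hence nonneg: "0 \<le> dual_objective \<Omega> M N \<phi>" using max[of "\<lambda>_. 0"] by simp
  have "(W2 N M)\<^sup>2 \<le> 2 * dual_objective \<Omega> M N \<phi> + e" if e: "e > 0" for e
  proof -
    obtain \<pi> u where \<pi>: "\<pi> \<in> couplings N M" and u: "continuous_on \<Omega> u"
      and le: "(\<integral>\<^sup>+ (y, x). ennreal ((norm (y - x))\<^sup>2) \<partial>\<pi>) \<le> ennreal (2 * dual_objective \<Omega> M N u + e)"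
      by (rule approximate_kantorovich_duality[OF \<Omega> N M e])
    note le
    also have "ennreal (2 * dual_objective \<Omega> M N u + e) \<le> ennreal (2 * dual_objective \<Omega> M N \<phi> + e)"
      using max[OF u] by (intro ennreal_leI) simp
    finally show ?thesis using nonneg e by (intro W2_square_le[OF \<pi>]) auto
  qed
  hence "(W2 N M)\<^sup>2 \<le> 2 * dual_objective \<Omega> M N \<phi>" by (rule field_le_epsilon)
  thus ?thesis by simp
qed

section \<open>Mirror descent\<close>

text \<open>The difference of the two sides vanishes at 0 and has derivative
  \<open>t - 1 + exp (- t)\<close>, which is nonnegative.\<close>

lemma exp_minus_le_quadratic:
  assumes "0 \<le> (x::real)"
  shows "exp (- x) \<le> 1 - x + x\<^sup>2 / 2"
proof -
  have "1 - 0 + 0\<^sup>2 / 2 - exp (- 0) \<le> 1 - x + x\<^sup>2 / 2 - exp (- x)"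
  proof (rule DERIV_nonneg_imp_nondecreasing[OF assms])
    fix t :: real assume "0 \<le> t" "t \<le> x"
    have "((\<lambda>t. 1 - t + t\<^sup>2 / 2 - exp (- t)) has_real_derivative (t - 1 + exp (- t))) (at t)"
      by (auto intro!: derivative_eq_intros)
    moreover have "0 \<le> t - 1 + exp (- t)" using exp_ge_add_one_self[of "- t"] by linarith
    ultimately show "\<exists>y. ((\<lambda>t. 1 - t + t\<^sup>2 / 2 - exp (- t)) has_real_derivative y) (at t) \<and> 0 \<le> y"
      by blast
  qed
  thus ?thesis by simp
qed

text \<open>Integrate the quadratic bound on \<open>exp (- x)\<close>, available because
  \<open>\<eta> * f x\<close> is nonnegative, and use \<open>ln z \<le> z - 1\<close>. This avoids
  any variance estimate.\<close>

lemma ln_exp_moment_le: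
  assumes "prob_space M" and f [measurable]: "f \<in> borel_measurable M"
    and b: "\<And>x. 0 \<le> f x \<and> f x \<le> (B::real)" and \<eta>: "0 \<le> \<eta>"
  shows "0 < (\<integral>x. exp (- \<eta> * f x) \<partial>M)"
    "ln (\<integral>x. exp (- \<eta> * f x) \<partial>M) \<le> - \<eta> * (\<integral>x. f x \<partial>M) + \<eta>\<^sup>2 * B\<^sup>2 / 2"
proof -
  interpret prob_space M by fact
  have fi: "integrable M f" using b by (intro integrable_const_bound[where B = B]) auto
  have ei: "integrable M (\<lambda>x. exp (- \<eta> * f x))"
    using b \<eta> by (intro integrable_const_bound[where B = 1]) auto
  have "exp (- \<eta> * B) \<le> (\<integral>x. exp (- \<eta> * f x) \<partial>M)"
    using b \<eta> by (intro integral_ge_const ei) (auto intro: mult_left_mono)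
  thus pos: "0 < (\<integral>x. exp (- \<eta> * f x) \<partial>M)" by (rule less_le_trans[OF exp_gt_zero])
  have "(\<integral>x. exp (- \<eta> * f x) \<partial>M) \<le> (\<integral>x. 1 - \<eta> * f x + \<eta>\<^sup>2 * B\<^sup>2 / 2 \<partial>M)"
  proof (intro integral_mono ei)
    fix x
    have "(\<eta> * f x)\<^sup>2 \<le> (\<eta> * B)\<^sup>2" using b[of x] \<eta> by (intro power_mono mult_left_mono) auto
    thus "exp (- \<eta> * f x) \<le> 1 - \<eta> * f x + \<eta>\<^sup>2 * B\<^sup>2 / 2"
      using exp_minus_le_quadratic[of "\<eta> * f x"] b[of x] \<eta> by (simp add: power_mult_distrib)
  qed (use fi in auto)
  also have "\<dots> = 1 - \<eta> * (\<integral>x. f x \<partial>M) + \<eta>\<^sup>2 * B\<^sup>2 / 2" using fi by (simp add: prob_space)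
  finally show "ln (\<integral>x. exp (- \<eta> * f x) \<partial>M) \<le> - \<eta> * (\<integral>x. f x \<partial>M) + \<eta>\<^sup>2 * B\<^sup>2 / 2"
    using ln_le_minus_one[OF pos] by linarith
qed

theorem theorem4p1:
  fixes \<Omega> :: "'a::euclidean_space set"
    and R a b :: real
    and n :: nat
    and w :: "nat \<Rightarrow> real"
    and \<mu> :: "nat \<Rightarrow> 'a measure"
    and lam_star :: "'a measure"
    and lam :: "nat \<Rightarrow> 'a measure"
    and \<rho> :: "nat \<Rightarrow> 'a \<Rightarrow> real"
    and \<phi> :: "nat \<Rightarrow> nat \<Rightarrow> 'a \<Rightarrow> real"
    and \<eta> :: "nat \<Rightarrow> real"
    and T :: nat
  assumes "compact \<Omega>" and "convex \<Omega>"
    and "R = (SUP x\<in>\<Omega>. norm x)"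
    and "\<And>i. i \<in> {1..n} \<Longrightarrow> \<mu> i \<in> prob_measures_on \<Omega>"
    and "\<And>i. i \<in> {1..n} \<Longrightarrow> 0 \<le> w i"
    and "(\<Sum>i=1..n. w i) = 1"
    and "is_arg_min (barycenter_energy n w \<mu>) (\<lambda>M. M \<in> prob_measures_on \<Omega>) lam_star"
    and "\<exists>i\<in>{1..n}. \<mu> i \<in> ac_prob_measures_on \<Omega>"
    and "lam 0 \<in> ac_prob_measures_on \<Omega>"
    and "0 < a" and "\<And>x. x \<in> \<Omega> \<Longrightarrow> a \<le> \<rho> 0 x \<and> \<rho> 0 x \<le> b"
    and "\<And>k. 0 < \<eta> k"
    and "\<And>k. has_density_on (lam k) (\<rho> k) \<Omega>"
    and "\<And>k i. i \<in> {1..n} \<Longrightarrow> kantorovich_potential \<Omega> (lam k) (\<mu> i) (\<phi> k i)"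
    and "\<And>k x. x \<in> \<Omega> \<Longrightarrow>
           \<rho> (Suc k) x =
             normalize_on \<Omega> (\<lambda>y. \<rho> k y * exp (- \<eta> k * (\<Sum>i=1..n. w i * \<phi> k i y))) x"
  shows "ereal (MIN k\<in>{0..T}. barycenter_energy n w \<mu> (lam k) - barycenter_energy n w \<mu> lam_star)
         \<le> D_KL lam_star (lam 0) / ereal (\<Sum>k=0..T. \<eta> k)
           + ereal (2 * R ^ 4 * ((\<Sum>k=0..T. (\<eta> k)\<^sup>2) / (\<Sum>k=0..T. \<eta> k)))"
proof -
  note \<Omega> = assms(1) and \<mu> = assms(4) and w = assms(5) and w1 = assms(6)
    and \<eta> = assms(12) and dens = assms(13) and pot = assms(14) and upd = assms(15)
  have star: "lam_star \<in> prob_measures_on \<Omega>" using assms(7) by (simp add: is_arg_min_def)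
  have lam0: "lam 0 \<in> prob_measures_on \<Omega>" using assms(9) by (simp add: ac_prob_measures_on_def)
  have \<Omega>b: "\<Omega> \<in> sets borel" using \<Omega> by (simp add: compact_imp_closed)
  have R: "norm x \<le> R" if "x \<in> \<Omega>" for x
  proof -
    have "bdd_above (norm ` \<Omega>)"
      using \<Omega> by (intro bounded_imp_bdd_above compact_imp_bounded compact_continuous_image continuous_intros)
    thus ?thesis unfolding assms(3) using that by (intro cSUP_upper)
  qed
  have conc: "c_concave_on \<Omega> (\<phi> k i)" "(INF x\<in>\<Omega>. \<phi> k i x) = 0" if "i \<in> {1..n}" for k i
    using pot[OF that] by (auto simp: kantorovich_potential_def)
  have \<phi>c: "continuous_on \<Omega> (\<phi> k i)" if "i \<in> {1..n}" for k i
    using continuous_on_c_concave[OF compact_imp_bounded[OF \<Omega>] conc(1)[OF that]] .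
  define F where "F = (\<lambda>k x. \<Sum>i=1..n. w i * \<phi> k i x)"
  \<comment> \<open>Truncation to \<Omega> gives a globally Borel and bounded function without
    changing integrals against measures carried by \<Omega>.\<close>
  define f where "f = (\<lambda>k x. indicator \<Omega> x *\<^sub>R F k x)"
  have Fc: "continuous_on \<Omega> (F k)" for k
    unfolding F_def by (intro continuous_intros \<phi>c)
  have fm [measurable]: "f k \<in> borel_measurable borel" for k
    unfolding f_def by (rule borel_measurable_continuous_on_indicator[OF \<Omega>b Fc])
  have fb: "0 \<le> f k x \<and> f k x \<le> 2 * R\<^sup>2" for k x
  proof (cases "x \<in> \<Omega>")
    case True
    note bd = c_concave_on_normalized_bounds[OF conc(1) R conc(2) True]
    have "F k x \<le> (\<Sum>i=1..n. w i * (2 * R\<^sup>2))"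
      unfolding F_def using w by (intro sum_mono mult_left_mono bd) auto
    also have "\<dots> = 2 * R\<^sup>2" using w1 by (simp flip: sum_distrib_right)
    finally have "F k x \<le> 2 * R\<^sup>2" .
    moreover have "0 \<le> F k x" unfolding F_def using w by (intro sum_nonneg mult_nonneg_nonneg bd) auto
    ultimately show ?thesis using True by (simp add: f_def)
  qed (simp add: f_def)

  \<comment> \<open>The iterates as successive exponential tiltings\<close>
  define Z where "Z = (\<lambda>k. \<integral>x. exp (- \<eta> k * f k x) \<partial>lam k)"
  \<comment> \<open>The recursion for Lebesgue densities becomes one relative to
    \<open>lam k\<close>. It also carries total mass 1 on \<Omega> to the next iterate, which
    \<open>has_density_on\<close> alone does not assert.\<close>
  have step: "lam (Suc k) \<in> prob_measures_on \<Omega> \<and>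
      lam (Suc k) = density (lam k) (\<lambda>x. ennreal (exp (- \<eta> k * f k x - ln (Z k))))"
    if k: "lam k \<in> prob_measures_on \<Omega>" for k
  proof -
    note lk = prob_measures_onD[OF k]
    interpret prob_space "lam k" by (rule lk)
    have mk: "f k \<in> borel_measurable (lam k)" using fm lk(2) by (simp cong: measurable_cong_sets)
    have Z0: "Z k > 0" unfolding Z_def
      using ln_exp_moment_le(1)[OF lk(1) mk fb, of "\<eta> k"] \<eta>[of k] by simp
    have ld: "lam k = density lborel (\<lambda>x. ennreal (indicator \<Omega> x * \<rho> k x))"
      and ld': "lam (Suc k) = density lborel (\<lambda>x. ennreal (indicator \<Omega> x * \<rho> (Suc k) x))"
      and rm [measurable]: "(\<lambda>x. indicator \<Omega> x * \<rho> k x) \<in> borel_measurable borel"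
      and r0: "x \<in> \<Omega> \<Longrightarrow> 0 \<le> \<rho> k x" for x
      using dens[of k] dens[of "Suc k"] by (auto simp: has_density_on_def set_borel_measurable_def)
    have r0': "0 \<le> indicator \<Omega> x * \<rho> k x" for x using r0 by (cases "x \<in> \<Omega>") auto
    have "Z k = (\<integral>x. (indicator \<Omega> x * \<rho> k x) * exp (- \<eta> k * f k x) \<partial>lborel)"
      unfolding Z_def ld using r0' by (subst integral_density) simp_all
    also have "\<dots> = (LINT y:\<Omega>|lborel. \<rho> k y * exp (- \<eta> k * (\<Sum>i=1..n. w i * \<phi> k i y)))"
      unfolding set_lebesgue_integral_def
      by (intro Bochner_Integration.integral_cong) (auto simp: f_def F_def indicator_def)
    finally have Zeq: "Z k = \<dots>" .
    have "density (lam k) (\<lambda>x. ennreal (exp (- \<eta> k * f k x - ln (Z k))))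
        = density lborel (\<lambda>x. ennreal (indicator \<Omega> x * \<rho> k x) * ennreal (exp (- \<eta> k * f k x - ln (Z k))))"
      unfolding ld by (subst density_density_eq) auto
    also have "\<dots> = lam (Suc k)"
      unfolding ld'
    proof (intro arg_cong[where f = "density lborel"] ext)
      fix x
      show "ennreal (indicator \<Omega> x * \<rho> k x) * ennreal (exp (- \<eta> k * f k x - ln (Z k)))
          = ennreal (indicator \<Omega> x * \<rho> (Suc k) x)"
      proof (cases "x \<in> \<Omega>")
        case True
        have "\<rho> (Suc k) x = \<rho> k x * exp (- \<eta> k * f k x - ln (Z k))"
          unfolding upd[OF True] normalize_on_def Zeq[symmetric]
          using True Z0 by (simp add: f_def F_def exp_diff)
        thus ?thesis using True r0[OF True] by (simp add: ennreal_mult)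
      qed simp
    qed
    finally have eq: "lam (Suc k) = density (lam k) (\<lambda>x. ennreal (exp (- \<eta> k * f k x - ln (Z k))))" ..
    have ei: "integrable (lam k) (\<lambda>x. exp (- \<eta> k * f k x))"
      using fb \<eta>[of k] mk by (intro integrable_const_bound[where B = 1]) (auto simp: less_imp_le)
    have ek: "exp (- \<eta> k * f k x - ln (Z k)) = exp (- \<eta> k * f k x) / Z k" for x
      using Z0 by (simp add: exp_diff)
    have sets': "sets (lam (Suc k)) = sets borel" unfolding ld' by simp
    have one: "emeasure (lam (Suc k)) A = 1" if A: "A \<in> sets borel" "\<Omega> \<subseteq> A" for A
    proof -
      have "emeasure (lam (Suc k)) A =
          (\<integral>\<^sup>+ x. ennreal (exp (- \<eta> k * f k x - ln (Z k))) * indicator A x \<partial>lam k)"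
        unfolding eq using mk A lk(2) by (subst emeasure_density) auto
      also have "\<dots> = (\<integral>\<^sup>+ x. ennreal (exp (- \<eta> k * f k x) / Z k) \<partial>lam k)"
        unfolding ek using AE_prob_measures_on[OF k \<Omega>] A(2)
        by (intro nn_integral_cong_AE) (auto elim!: eventually_mono)
      also have "\<dots> = ennreal (\<integral>x. exp (- \<eta> k * f k x) / Z k \<partial>lam k)"
        using ei Z0 by (intro nn_integral_eq_integral) auto
      also have "\<dots> = 1" using Z0 by (simp add: Z_def)
      finally show ?thesis .
    qed
    have "prob_space (lam (Suc k))"
      using one[of UNIV] sets_eq_imp_space_eq[OF sets'] by (intro prob_spaceI) simp
    thus ?thesis using eq sets' one[OF \<Omega>b] by (simp add: prob_measures_on_def)
  qed
  have lam: "lam k \<in> prob_measures_on \<Omega>" for k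
    by (induction k) (rule lam0, rule step[THEN conjunct1])
  have fint: "integrable M (f k)" if "M \<in> prob_measures_on \<Omega>" for M k
    using set_integrable_continuous_on[OF that \<Omega> Fc, of k] by (simp add: f_def set_integrable_def)
  \<comment> \<open>The logarithm of the density of \<open>lam k\<close> with respect to
    \<open>lam 0\<close>, accumulated over the steps below \<open>k\<close>.\<close>
  define g where "g = (\<lambda>k x. \<Sum>l<k. - \<eta> l * f l x - ln (Z l))"
  have gm [measurable]: "g k \<in> borel_measurable borel" for k unfolding g_def by measurable
  have lam_g: "lam k = density (lam 0) (\<lambda>x. ennreal (exp (g k x)))" for k
  proof (induction k)
    case 0
    show ?case by (simp add: g_def density_1)
  next
    case (Suc k)
    have m0: "borel_measurable (lam 0) = (borel_measurable borel :: ('a \<Rightarrow> real) set)"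
      by (rule measurable_cong_sets[OF prob_measures_onD(2)[OF lam0] refl])
    have "lam (Suc k) = density (density (lam 0) (\<lambda>x. ennreal (exp (g k x))))
        (\<lambda>x. ennreal (exp (- \<eta> k * f k x - ln (Z k))))"
      unfolding Suc[symmetric] by (rule step[OF lam, THEN conjunct2])
    also have "\<dots> = density (lam 0) (\<lambda>x. ennreal (exp (g k x)) * ennreal (exp (- \<eta> k * f k x - ln (Z k))))"
      using gm[of k] fm[of k] m0 by (intro density_density_eq) (simp_all add: measurable_compose[OF _ measurable_ennreal])
    also have "\<dots> = density (lam 0) (\<lambda>x. ennreal (exp (g (Suc k) x)))"
      by (simp add: g_def exp_add ennreal_mult[symmetric])
    finally show ?case .
  qed

  \<comment> \<open>Subgradient inequality for the energy\<close>
  have energy: "barycenter_energy n w \<mu> (lam k) - barycenter_energy n w \<mu> lam_star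
      \<le> (\<integral>x. f k x \<partial>lam k) - (\<integral>x. f k x \<partial>lam_star)" for k
  proof -
    have sumf: "(\<integral>x. f k x \<partial>M) = (\<Sum>i=1..n. w i * (LINT x:\<Omega>|M. \<phi> k i x))"
      if M: "M \<in> prob_measures_on \<Omega>" for M
    proof -
      have "f k = (\<lambda>x. \<Sum>i=1..n. w i * (indicator \<Omega> x *\<^sub>R \<phi> k i x))"
        by (auto simp: f_def F_def sum_distrib_left algebra_simps)
      thus ?thesis
        using set_integrable_continuous_on[OF M \<Omega> \<phi>c]
        unfolding set_lebesgue_integral_def set_integrable_def
        by (simp add: Bochner_Integration.integral_sum)
    qed
    have "barycenter_energy n w \<mu> (lam k) - barycenter_energy n w \<mu> lam_star
        = (\<Sum>i=1..n. w i * ((W2 (\<mu> i) (lam k))\<^sup>2 / 2 - (W2 (\<mu> i) lam_star)\<^sup>2 / 2))"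
      by (simp add: barycenter_energy_def sum_subtractf algebra_simps)
    \<comment> \<open>Strong duality at \<open>lam k\<close> and weak duality at
      \<open>lam_star\<close> contain the same integral of the transform over
      \<open>\<mu> i\<close>; it cancels in the difference.\<close>
    also have "\<dots> \<le> (\<Sum>i=1..n. w i * ((LINT x:\<Omega>|lam k. \<phi> k i x) - (LINT x:\<Omega>|lam_star. \<phi> k i x)))"
    proof (intro sum_mono mult_left_mono w)
      fix i assume i: "i \<in> {1..n}"
      show "(W2 (\<mu> i) (lam k))\<^sup>2 / 2 - (W2 (\<mu> i) lam_star)\<^sup>2 / 2
          \<le> (LINT x:\<Omega>|lam k. \<phi> k i x) - (LINT x:\<Omega>|lam_star. \<phi> k i x)"
        using kantorovich_potential_W2[OF \<Omega> \<mu>[OF i] lam pot[OF i], of k]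
          dual_objective_le_W2[OF \<Omega> \<mu>[OF i] star \<phi>c[OF i, of k]]
        unfolding dual_objective_def by linarith
    qed
    also have "\<dots> = (\<integral>x. f k x \<partial>lam k) - (\<integral>x. f k x \<partial>lam_star)"
      by (simp add: sumf[OF lam] sumf[OF star] right_diff_distrib sum_subtractf)
    finally show ?thesis .
  qed

  \<comment> \<open>Summation over the iterations\<close>
  define S where "S = (\<Sum>k=0..T. \<eta> k)"
  define m where "m = (MIN k\<in>{0..T}. barycenter_energy n w \<mu> (lam k) - barycenter_energy n w \<mu> lam_star)"
  have S: "S > 0" unfolding S_def using \<eta> by (intro sum_pos) auto
  show ?thesis
  proof (cases "absolutely_continuous (lam 0) lam_star \<and> integrable lam_star (entropy_density (exp 1) (lam 0) lam_star)")
    case False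
    hence "D_KL lam_star (lam 0) = \<infinity>" by (simp add: D_KL_def)
    thus ?thesis using S by (simp add: S_def[symmetric])
  next
    case True
    interpret star: prob_space lam_star by (rule prob_measures_onD[OF star])
    let ?KL = "KL_divergence (exp 1) (lam 0) lam_star"
    have "\<eta> k * m \<le> (\<integral>x. - \<eta> k * f k x - ln (Z k) \<partial>lam_star) + 2 * R ^ 4 * (\<eta> k)\<^sup>2"
      if k: "k \<in> {0..T}" for k
    proof -
      have mk: "f k \<in> borel_measurable (lam k)" by (rule borel_measurable_integrable[OF fint[OF lam]])
      have "m \<le> barycenter_energy n w \<mu> (lam k) - barycenter_energy n w \<mu> lam_star"
        unfolding m_def using k by (intro Min_le) auto
      also note energy[of k]
      finally have "\<eta> k * m \<le> \<eta> k * ((\<integral>x. f k x \<partial>lam k) - (\<integral>x. f k x \<partial>lam_star))"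
        using \<eta>[of k] by (intro mult_left_mono) auto
      moreover have "ln (Z k) \<le> - \<eta> k * (\<integral>x. f k x \<partial>lam k) + (\<eta> k)\<^sup>2 * (2 * R\<^sup>2)\<^sup>2 / 2"
        unfolding Z_def using ln_exp_moment_le(2)[OF prob_measures_onD(1)[OF lam] mk fb less_imp_le[OF \<eta>]] .
      \<comment> \<open>The constant in the final bound: half the square of the range
        \<open>2 * R\<^sup>2\<close> of the averaged potential.\<close>
      moreover have "(\<eta> k)\<^sup>2 * (2 * R\<^sup>2)\<^sup>2 / 2 = 2 * R ^ 4 * (\<eta> k)\<^sup>2"
        by (simp add: power_mult_distrib flip: power_mult)
      moreover have "(\<integral>x. - \<eta> k * f k x - ln (Z k) \<partial>lam_star) = - \<eta> k * (\<integral>x. f k x \<partial>lam_star) - ln (Z k)"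
        using fint[OF star, of k] by (simp add: star.prob_space)
      ultimately show ?thesis by (simp add: algebra_simps)
    qed
    hence "(\<Sum>k=0..T. \<eta> k * m) \<le> (\<Sum>k=0..T. (\<integral>x. - \<eta> k * f k x - ln (Z k) \<partial>lam_star) + 2 * R ^ 4 * (\<eta> k)\<^sup>2)"
      by (rule sum_mono)
    \<comment> \<open>The index is \<open>Suc T\<close> because \<open>g k\<close> sums over indices
      strictly below \<open>k\<close>.\<close>
    also have "\<dots> = (\<integral>x. g (Suc T) x \<partial>lam_star) + 2 * R ^ 4 * (\<Sum>k=0..T. (\<eta> k)\<^sup>2)"
      unfolding g_def using fint[OF star]
      by (subst Bochner_Integration.integral_sum)
         (simp_all add: sum.distrib sum_distrib_left lessThan_Suc_atMost atMost_atLeast0)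
    \<comment> \<open>The exponential of \<open>g (Suc T)\<close> is the density of
      \<open>lam (Suc T)\<close> with respect to \<open>lam 0\<close> and so has integral 1. The
      inequality amounts to discarding the nonnegative divergence of \<open>lam_star\<close> from
      \<open>lam (Suc T)\<close>.\<close>
    also have "(\<integral>x. g (Suc T) x \<partial>lam_star) \<le> ?KL"
    proof (rule donsker_varadhan)
      show "prob_space (lam 0)" "prob_space lam_star" using prob_measures_onD lam0 star by blast+
      show "sets lam_star = sets (lam 0)" using prob_measures_onD(2)[OF lam0] prob_measures_onD(2)[OF star] by simp
      show "integrable lam_star (g (Suc T))" unfolding g_def using fint[OF star] by auto
      have m0: "(\<lambda>x. exp (g (Suc T) x)) \<in> borel_measurable (lam 0)"
        using gm[of "Suc T"] prob_measures_onD(2)[OF lam0] by (simp cong: measurable_cong_sets)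
      have "(\<integral>\<^sup>+ x. ennreal (exp (g (Suc T) x)) \<partial>lam 0) = emeasure (lam (Suc T)) (space (lam (Suc T)))"
        unfolding lam_g[of "Suc T"] using m0
        by (subst emeasure_density) (auto intro!: nn_integral_cong)
      also have "\<dots> = 1" using prob_measures_onD(1)[OF lam] by (rule prob_space.emeasure_space_1)
      finally have nn: "(\<integral>\<^sup>+ x. ennreal (exp (g (Suc T) x)) \<partial>lam 0) = 1" .
      show i: "integrable (lam 0) (\<lambda>x. exp (g (Suc T) x))"
        using nn m0 by (intro integrableI_nonneg) auto
      show "(\<integral>x. exp (g (Suc T) x) \<partial>lam 0) = 1"
        using nn by (subst (asm) nn_integral_eq_integral[OF i]) auto
    qed (use True in auto)
    finally have "S * m \<le> ?KL + 2 * R ^ 4 * (\<Sum>k=0..T. (\<eta> k)\<^sup>2)"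
      by (simp add: S_def sum_distrib_right)
    hence "m \<le> ?KL / S + 2 * R ^ 4 * ((\<Sum>k=0..T. (\<eta> k)\<^sup>2) / S)"
      using S by (simp add: field_simps)
    thus ?thesis using True S by (simp add: D_KL_def S_def[symmetric] m_def[symmetric])
  qed
qed

end
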